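(* Let $N$ be a lattice of rank $2$ with basis $(e_1,e_2)$, and let $l\subset N_{\mathbb{R}}$ be a half-line with origin $0$ contained (apart from $0$) in the interior of the cone $\sigma(e_1,e_2)$. Then: (1) For each $i\in\{1,2\}$, the polygonal line $Q_i(l)$ is the boundary of the convex hull of the set of nonzero points of the lattice $N$ contained in the strictly convex closed cone with sides $\mathbb{R}_+e_i$ and $l$. (2) Group the petals $\tau_0,\tau_1,\dots$ of the sheath $G(l)$ into maximal packets of successive triangles having the same symbol, with the convention that the first packet always consists of petals turning to the right (symbol $\delta$; so this first packet is empty if $\tau_0$ has symbol $\gamma$). Let $a_1,a_2,\dots$ be the cardinalities of the successive packets. If $\lambda$ denotes the inclination of $l$ in the basis $(e_1,e_2)$, then $$\lambda=[a_1,a_2,\dots]^+ .$$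
   Context: $N_{\mathbb{R}}=N\otimes_{\mathbb{Z}}\mathbb{R}$, and $\sigma(e_1,e_2)$ is the convex cone generated by $e_1,e_2$. Notation: $[x_1,x_2,\dots]^{+}=x_1+\cfrac{1}{x_2+\cfrac{1}{\cdots}}$ (finite or infinite). The *inclination* of $l$ is $x_1/x_2$ if $x_1e_1+x_2e_2$ is a direction vector of $l$. *Lotus.* For a basis $(u,v)$ of $N$ let $\tau(u,v)$ be the triangle with vertices $u,v,u+v$. The lotus $\mathcal{L}(e_1,e_2)$ is the infinite simplicial complex whose triangles, called *petals*, are obtained by starting from $\tau(e_1,e_2)$ and, for each petal $\tau(u,v)$ already built, adding the petals $\tau(u,u+v)$ and $\tau(u+v,v)$. If $\tau(u,v)$ is a petal written so that $(u,v)$ has the same orientation as $(e_1,e_2)$, its base is $[u,v]$, its *right* side is $[u,u+v]$ and its *left* side is $[v,u+v]$. *Sheath (gaine).* $G(l)$ is the union of the petals of $\mathcal{L}(e_1,e_2)$ whose interiors meet $l$. They are ordered as $\tau_0=\tau(e_1,e_2),\tau_1,\tau_2,\dots$ according to the order in which $l$ enters them when moving away from $0$. If $l$ is rational (contains nonzero points of $N$), let $S(l)$ be the unique primitive element of $N$ on $l$; there are then finitely many petals $\tau_0,\dots,\tau_n$ and $S(l)$ is a vertex of $\tau_n$. If $l$ is irrational, the sequence of petals is infinite. *Symbols.* To each petal $\tau_i$ one associates the symbol $\delta$ if $\tau_{i+1}$ is attached to the right side of $\tau_i$ and $\gamma$ if it is attached to the left side; if $l$ is rational, the last petal gets the same symbol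 as the last but one (if there is only one petal, it gets the symbol $\delta$). *Polygonal lines.* For $i=1,2$: if $l$ is rational, $P_i(l)$ is the polygonal line joining $e_i$ to $S(l)$ in the boundary of $G(l)$ and not containing the open segment $]e_1,e_2[$; if $l$ is irrational, $P_i(l)$ is the connected component of $\partial G(l)\setminus]e_1,e_2[$ containing $e_i$. Let $d_i$ be the closed half-line contained in $\mathbb{R}e_i$, with origin $e_i$ and not containing $0$. Define $Q_i(l)=d_i\cup P_i(l)\cup(l\setminus[0,S(l)])$ if $l$ is rational and $Q_i(l)=d_i\cup P_i(l)$ if $l$ is irrational. *)

theory Defs
  imports "HOL-Analysis.Analysis" "HOL-Library.Extended_Nat"
begin

text \<open>
  The plane \<open>N \<otimes> \<real>\<close> is modelled by an arbitrary two-dimensional Euclidean space; its inner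
  product serves only to provide the usual topology, and to order points along a half-line.
\<close>

definition lattice_basis :: "'a::real_vector set \<Rightarrow> 'a \<Rightarrow> 'a \<Rightarrow> bool" where
  "lattice_basis N u v \<longleftrightarrow>
     u \<noteq> v \<and> independent {u, v} \<and>
     N = {of_int m *\<^sub>R u + of_int n *\<^sub>R v | m n :: int. True}"

definition half_line_from_0 :: "'a::real_vector set \<Rightarrow> bool" where
  "half_line_from_0 l \<longleftrightarrow> (\<exists>w. w \<noteq> 0 \<and> l = {t *\<^sub>R w | t. 0 \<le> t})"

definition inclination :: "'a::real_vector \<Rightarrow> 'a \<Rightarrow> 'a set \<Rightarrow> real" where
  "inclination e1 e2 l =
     (THE r. \<exists>x1 x2. x1 *\<^sub>R e1 + x2 *\<^sub>R e2 \<in> l - {0} \<and> r = x1 / x2)"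

definition rational :: "'a::real_vector set \<Rightarrow> 'a set \<Rightarrow> bool" where
  "rational N l \<longleftrightarrow> (\<exists>x \<in> N \<inter> l. x \<noteq> 0)"

definition primitive :: "'a::real_vector set \<Rightarrow> 'a \<Rightarrow> bool" where
  "primitive N x \<longleftrightarrow>
     x \<in> N \<and> x \<noteq> 0 \<and> (\<forall>y \<in> N. \<forall>k::int. x = of_int k *\<^sub>R y \<longrightarrow> \<bar>k\<bar> = 1)"

definition prim_point :: "'a::real_vector set \<Rightarrow> 'a set \<Rightarrow> 'a" where
  "prim_point N l = (THE x. x \<in> l \<and> primitive N x)"


text \<open>
  \<open>enum_by f A k\<close> is the element of \<open>A\<close> that comes in position \<open>k\<close> (counted from \<open>0\<close>) when the
  elements of \<open>A\<close> are listed by increasing value of \<open>f\<close>.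
\<close>

definition enum_by :: "('b \<Rightarrow> 'c::linorder) \<Rightarrow> 'b set \<Rightarrow> nat \<Rightarrow> 'b" where
  "enum_by f A k =
     (THE x. x \<in> A \<and> finite {y \<in> A. f y < f x} \<and> card {y \<in> A. f y < f x} = k)"


text \<open>
  A petal is represented by the pair \<open>(u, v)\<close> of endpoints of its base. Both steps
  \<open>(u, v) \<mapsto> (u, u + v)\<close> and \<open>(u, v) \<mapsto> (u + v, v)\<close> have determinant \<open>1\<close>, so every pair occurring
  here has the same orientation as \<open>(e1, e2)\<close>.
\<close>

inductive_set lotus :: "'a::real_vector \<Rightarrow> 'a \<Rightarrow> ('a \<times> 'a) set" for e1 e2 where
  start: "(e1, e2) \<in> lotus e1 e2"
| right: "(u, v) \<in> lotus e1 e2 \<Longrightarrow> (u, u + v) \<in> lotus e1 e2"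
| left: "(u, v) \<in> lotus e1 e2 \<Longrightarrow> (u + v, v) \<in> lotus e1 e2"

fun triangle :: "'a::real_vector \<times> 'a \<Rightarrow> 'a set" where
  "triangle (u, v) = convex hull {u, v, u + v}"

fun base :: "'a::real_vector \<times> 'a \<Rightarrow> 'a set" where
  "base (u, v) = closed_segment u v"

text \<open>\<open>Sym_delta\<close> stands for right and \<open>Sym_gamma\<close> for left (French: droite, gauche).\<close>

datatype symbol = Sym_delta | Sym_gamma

fun side :: "symbol \<Rightarrow> 'a::real_vector \<times> 'a \<Rightarrow> 'a set" where
  "side Sym_delta (u, v) = closed_segment u (u + v)"
| "side Sym_gamma (u, v) = closed_segment v (u + v)"

definition sheath_petals :: "'a::euclidean_space \<Rightarrow> 'a \<Rightarrow> 'a set \<Rightarrow> ('a \<times> 'a) set" where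
  "sheath_petals e1 e2 l = {p \<in> lotus e1 e2. interior (triangle p) \<inter> l \<noteq> {}}"

definition sheath :: "'a::euclidean_space \<Rightarrow> 'a \<Rightarrow> 'a set \<Rightarrow> 'a set" where
  "sheath e1 e2 l = (\<Union>p \<in> sheath_petals e1 e2 l. triangle p)"

text \<open>The point where \<open>l\<close> enters a petal is the point of the petal on \<open>l\<close> nearest to \<open>0\<close>.\<close>

definition petal :: "'a::euclidean_space \<Rightarrow> 'a \<Rightarrow> 'a set \<Rightarrow> nat \<Rightarrow> 'a \<times> 'a" where
  "petal e1 e2 l = enum_by (\<lambda>p. infdist 0 (l \<inter> triangle p)) (sheath_petals e1 e2 l)"

definition petal_indices :: "'a::euclidean_space \<Rightarrow> 'a \<Rightarrow> 'a set \<Rightarrow> nat set" where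
  "petal_indices e1 e2 l =
     {i. finite (sheath_petals e1 e2 l) \<longrightarrow> i < card (sheath_petals e1 e2 l)}"

definition turn :: "'a::euclidean_space \<Rightarrow> 'a \<Rightarrow> 'a set \<Rightarrow> nat \<Rightarrow> symbol" where
  "turn e1 e2 l i = (THE s. base (petal e1 e2 l (Suc i)) = side s (petal e1 e2 l i))"

definition petal_symbol :: "'a::euclidean_space \<Rightarrow> 'a \<Rightarrow> 'a set \<Rightarrow> nat \<Rightarrow> symbol" where
  "petal_symbol e1 e2 l i =
     (if Suc i \<in> petal_indices e1 e2 l then turn e1 e2 l i
      else if i = 0 then Sym_delta
      else turn e1 e2 l (i - 1))"


text \<open>Packets are represented as sets of indices of petals.\<close>

definition uniform_packet :: "'a::euclidean_space \<Rightarrow> 'a \<Rightarrow> 'a set \<Rightarrow> nat set \<Rightarrow> bool" where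
  "uniform_packet e1 e2 l I \<longleftrightarrow>
     I \<noteq> {} \<and> I \<subseteq> petal_indices e1 e2 l \<and>
     (\<forall>i \<in> I. \<forall>j \<in> I. {i..j} \<subseteq> I) \<and>
     (\<forall>i \<in> I. \<forall>j \<in> I. petal_symbol e1 e2 l i = petal_symbol e1 e2 l j)"

definition maximal_packets :: "'a::euclidean_space \<Rightarrow> 'a \<Rightarrow> 'a set \<Rightarrow> nat set set" where
  "maximal_packets e1 e2 l =
     {I. uniform_packet e1 e2 l I \<and>
         (\<forall>J. uniform_packet e1 e2 l J \<and> I \<subseteq> J \<longrightarrow> J = I)}"

text \<open>
  The packets in order, after insertion of an empty packet in front if the first petal turns left.
  They are counted from \<open>0\<close>, so the cardinality of \<open>packet e1 e2 l k\<close> is $a_{k+1}$.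
\<close>

definition packet :: "'a::euclidean_space \<Rightarrow> 'a \<Rightarrow> 'a set \<Rightarrow> nat \<Rightarrow> nat set" where
  "packet e1 e2 l k =
     (if petal_symbol e1 e2 l 0 = Sym_delta then enum_by Inf (maximal_packets e1 e2 l) k
      else case k of 0 \<Rightarrow> {} | Suc j \<Rightarrow> enum_by Inf (maximal_packets e1 e2 l) j)"

definition num_packets :: "'a::euclidean_space \<Rightarrow> 'a \<Rightarrow> 'a set \<Rightarrow> enat" where
  "num_packets e1 e2 l =
     (if finite (maximal_packets e1 e2 l) then enat (card (maximal_packets e1 e2 l)) else \<infinity>) +
     (if petal_symbol e1 e2 l 0 = Sym_delta then 0 else 1)"


fun cfrac :: "real list \<Rightarrow> real" where
  "cfrac [x] = x"
| "cfrac (x # y # xs) = x + 1 / cfrac (y # xs)"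

text \<open>
  \<open>has_cfrac r a m\<close> says that \<open>r\<close> is the value of the continued fraction, finite or infinite
  according to \<open>m\<close>, with partial quotients \<open>a 0, a 1, \<dots>\<close> (\<open>m\<close> of them).
\<close>

definition has_cfrac :: "real \<Rightarrow> (nat \<Rightarrow> real) \<Rightarrow> enat \<Rightarrow> bool" where
  "has_cfrac r a m \<longleftrightarrow>
     (case m of
        enat n \<Rightarrow> n > 0 \<and> r = cfrac (map a [0..<n])
      | \<infinity> \<Rightarrow> (\<lambda>n. cfrac (map a [0..<Suc n])) \<longlonglongrightarrow> r)"


fun polygonal_path :: "'a::real_normed_vector list \<Rightarrow> real \<Rightarrow> 'a" where
  "polygonal_path [a] = linepath a a"
| "polygonal_path [a, b] = linepath a b"
| "polygonal_path (a # b # c # vs) = linepath a b +++ polygonal_path (b # c # vs)"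

definition joining_polygonal_line :: "'a::real_normed_vector \<Rightarrow> 'a \<Rightarrow> 'a set \<Rightarrow> bool" where
  "joining_polygonal_line a b A \<longleftrightarrow>
     (\<exists>vs. vs \<noteq> [] \<and> hd vs = a \<and> last vs = b \<and> arc (polygonal_path vs) \<and>
           A = path_image (polygonal_path vs))"

text \<open>In the following two definitions \<open>e\<close> is one of \<open>e1\<close>, \<open>e2\<close>.\<close>

definition P_line :: "'a::euclidean_space set \<Rightarrow> 'a \<Rightarrow> 'a \<Rightarrow> 'a set \<Rightarrow> 'a \<Rightarrow> 'a set" where
  "P_line N e1 e2 l e =
     (if rational N l
      then (THE A. joining_polygonal_line e (prim_point N l) A \<and>
                   A \<subseteq> frontier (sheath e1 e2 l) \<and> \<not> open_segment e1 e2 \<subseteq> A)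
      else connected_component_set (frontier (sheath e1 e2 l) - open_segment e1 e2) e)"

definition Q_line :: "'a::euclidean_space set \<Rightarrow> 'a \<Rightarrow> 'a \<Rightarrow> 'a set \<Rightarrow> 'a \<Rightarrow> 'a set" where
  "Q_line N e1 e2 l e =
     {t *\<^sub>R e | t. 1 \<le> t} \<union> P_line N e1 e2 l e \<union>
     (if rational N l then l - closed_segment 0 (prim_point N l) else {})"

end

(*
  Let w span l. The petals of the sheath are the pairs (U i, V i) produced by the subtractive Euclidean
  algorithm applied to the coordinates (A i, B i) of w: the turn is to the right if B i < A i and to the
  left if A i < B i, and l is rational iff A i = B i for some i. A maximal run of equal turns is one
  division with remainder, whence the continued fraction of A 0 / B 0.

  For the polygonal lines, let D be the determinant in the basis (e1, e2). A nonzero lattice point x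
  between e1 and l lies strictly to the right of V i, so the integer D x (V i) is positive, that is, at
  least 1. The lines D x (V i) = 1 carry the edges [U i, U i + V i] of the right boundary of the sheath;
  hence the hull consists exactly of the multiples s y with s >= 1 of the points y of that boundary. Its
  interior misses every petal, since D x (V i) <= 1 on the i-th one, which also shows that those edges
  are in the frontier of the sheath. The left side is obtained by exchanging e1 and e2.
*)

theory Submission
  imports Defs
begin


section \<open>Enumerations and continued fractions\<close>

text \<open>Two places need more than the geometry of the edges. First, \<open>P_line\<close> is
  given by a description: for rational \<open>l\<close> the boundary of the sheath is a closed
  curve, and a connectedness argument shows that only one of its arcs meets the conditions; for
  irrational \<open>l\<close> the line through \<open>l\<close> separates the two sides. Second, the
  infinite case needs a quantity that tends to infinity along the petals. The sum of the two
  coordinates of the vertices does, and it serves three times: the sheath is closed, the sectors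
  over the edges cover the whole hull, and an endless algorithm leaves no nonzero lattice point on
  \<open>l\<close>. At the last petal of a rational sheath \<open>A i = B i\<close>, so a quotient 1
  is still to be counted. The convention on the last symbol puts this petal into the last packet,
  and the last partial quotient comes out exact. At the other end the first partial quotient may be
  0, so the convergence estimates start at the second one.\<close>

lemma enum_by_image:
  assumes mono: "\<And>i j. \<lbrakk>i \<in> I; j \<in> I; i < j\<rbrakk> \<Longrightarrow> f (g i) < f (g j)"
    and down: "\<And>i j. \<lbrakk>j \<in> I; i \<le> j\<rbrakk> \<Longrightarrow> i \<in> I"
    and k: "k \<in> I"
  shows "enum_by f (g ` I) k = g k"
proof -
  have iff: "f (g j) < f (g i) \<longleftrightarrow> j < i" if "i \<in> I" "j \<in> I" for i j
    using mono[of i j] mono[of j i] that by (cases i j rule: linorder_cases) auto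
  \<comment> \<open>\<open>I\<close> is an initial segment, so every \<open>j < i\<close>
    contributes an element and the rank of \<open>g i\<close> is exactly \<open>i\<close>.\<close>
  have below: "{y \<in> g ` I. f y < f (g i)} = g ` {..<i}" if "i \<in> I" for i
  proof safe
    fix j assume "j \<in> I" "f (g j) < f (g i)"
    then show "g j \<in> g ` {..<i}" using iff[OF that] by simp
  next
    fix j assume j: "j < i"
    then have "j \<in> I" using down[OF that] by simp
    then show "g j \<in> g ` I" "f (g j) < f (g i)" using iff[OF that] j by simp_all
  qed
  have inj: "inj_on g I"
    using iff by (intro inj_onI) (metis less_irrefl linorder_neqE_nat)
  have card: "card {y \<in> g ` I. f y < f (g i)} = i" if "i \<in> I" for i
  proof -
    have "{..<i} \<subseteq> I" using down[OF that] by auto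
    then have "inj_on g {..<i}" using inj inj_on_subset by blast
    then show ?thesis by (simp add: below that card_image)
  qed
  show ?thesis
    unfolding enum_by_def
  proof (rule the_equality)
    show "g k \<in> g ` I \<and> finite {y \<in> g ` I. f y < f (g k)} \<and> card {y \<in> g ` I. f y < f (g k)} = k"
      using k card by (simp add: below)
  next
    fix x assume "x \<in> g ` I \<and> finite {y \<in> g ` I. f y < f x} \<and> card {y \<in> g ` I. f y < f x} = k"
    then show "x = g k" using card by (elim conjE imageE) simp
  qed
qed

lemma cfrac_upt_Suc:
  "cfrac (map a [k..<Suc (Suc (k + n))]) = a k + 1 / cfrac (map a [Suc k..<Suc (Suc k + n)])"
  by (simp add: upt_conv_Cons del: upt_Suc)

lemma cfrac_ge_1:
  assumes "\<And>j. k \<le> j \<Longrightarrow> 1 \<le> a j"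
  shows "1 \<le> cfrac (map a [k..<Suc (k + n)])"
  using assms
proof (induction n arbitrary: k)
  case 0
  then show ?case by simp
next
  case (Suc n)
  have "1 \<le> cfrac (map a [Suc k..<Suc (Suc k + n)])" by (rule Suc.IH) (use Suc.prems in auto)
  moreover have "1 \<le> a k" using Suc.prems by simp
  ultimately show ?case using cfrac_upt_Suc[of a k n]
    by (simp add: add_increasing2 del: upt_Suc)
qed

text \<open>The map t -> 1 / (r + 1 / t) = t / (r t + 1) has derivative 1 / (r t + 1)^2, which is at
  most 1/4 for r, t >= 1.\<close>

lemma two_step_contraction:
  fixes r y d :: real
  assumes "1 \<le> r" "1 \<le> y" "1 \<le> d"
  shows "\<bar>1 / (r + 1 / y) - 1 / (r + 1 / d)\<bar> \<le> \<bar>y - d\<bar> / 4"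
proof -
  have ge: "1 \<le> r * y" "1 \<le> r * d" using mult_mono[of 1 r 1 y] mult_mono[of 1 r 1 d] assms by auto
  have flip: "1 / (r + 1 / t) = t / (r * t + 1)" if "1 \<le> t" for t
    using that by (simp add: field_simps)
  have "1 / (r + 1 / y) - 1 / (r + 1 / d) = (y * (r * d + 1) - d * (r * y + 1)) / ((r * y + 1) * (r * d + 1))"
    unfolding flip[OF assms(2)] flip[OF assms(3)] by (rule diff_frac_eq) (use ge in auto)
  also have "y * (r * d + 1) - d * (r * y + 1) = y - d" by (simp add: algebra_simps)
  finally have eq: "1 / (r + 1 / y) - 1 / (r + 1 / d) = (y - d) / ((r * y + 1) * (r * d + 1))" .
  have "2 * 2 \<le> (r * y + 1) * (r * d + 1)"
    using ge by (intro mult_mono) linarith+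
  then have "4 \<le> \<bar>(r * y + 1) * (r * d + 1)\<bar>" by linarith
  then show ?thesis
    unfolding eq abs_divide by (intro divide_left_mono) (linarith | simp)+
qed

text \<open>
  A single step of the expansion need not bring the approximation closer by a fixed factor, hence the
  induction in steps of two.
\<close>

lemma cfrac_error:
  fixes a x :: "nat \<Rightarrow> real"
  assumes a: "\<And>j. k \<le> j \<Longrightarrow> 1 \<le> a j" and x: "\<And>j. k \<le> j \<Longrightarrow> 1 \<le> x j"
    and step: "\<And>j. k \<le> j \<Longrightarrow> x j = a j + 1 / x (Suc j)"
  shows "\<bar>x k - cfrac (map a [k..<Suc (k + n)])\<bar> \<le> 2 / 2 ^ n"
  using assms
proof (induction n arbitrary: k rule: induct_nat_012)
  case 0
  have "x k = a k + 1 / x (Suc k)" "1 \<le> x (Suc k)" using 0(2)[of "Suc k"] 0(3)[of k] by auto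
  moreover from this have "0 < 1 / x (Suc k) \<and> 1 / x (Suc k) \<le> 1" by simp
  moreover have "cfrac (map a [k..<Suc (k + 0)]) = a k" by simp
  ultimately show ?case unfolding power_0 by linarith
next
  \<comment> \<open>Two numbers in ]0, 1] differ by at most 1 = 2 / 2 ^ 1; this crude estimate
    accounts for the numerator 2.\<close>
  case (1 k)
  have eq: "cfrac (map a [k..<Suc (k + Suc 0)]) = a k + 1 / a (Suc k)"
    by (simp add: upt_conv_Cons)
  have "x k = a k + 1 / x (Suc k)" by (rule 1(3)) simp
  moreover have "0 < 1 / t \<and> 1 / t \<le> 1" if "1 \<le> t" for t :: real using that by simp
  then have "0 < 1 / x (Suc k) \<and> 1 / x (Suc k) \<le> 1" "0 < 1 / a (Suc k) \<and> 1 / a (Suc k) \<le> 1"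
    using 1(1)[of "Suc k"] 1(2)[of "Suc k"] by auto
  moreover have "2 / 2 ^ Suc 0 = (1 :: real)" by simp
  ultimately show ?case unfolding eq by linarith
next
  case (ge2 n k)
  define c where "c = cfrac (map a [Suc (Suc k)..<Suc (Suc (Suc k) + n)])"
  have "1 \<le> c" using cfrac_ge_1[of "Suc (Suc k)" a n] ge2.prems(1) by (simp only: c_def)
  moreover have "1 \<le> a (Suc k)" "1 \<le> x (Suc (Suc k))" using ge2.prems(1,2) by auto
  moreover have "x k = a k + 1 / (a (Suc k) + 1 / x (Suc (Suc k)))"
  proof -
    have "x k = a k + 1 / x (Suc k)" by (rule ge2.prems(3)) simp
    moreover have "x (Suc k) = a (Suc k) + 1 / x (Suc (Suc k))" by (rule ge2.prems(3)) simp
    ultimately show ?thesis by (rule back_subst[where P = "\<lambda>t. x k = a k + 1 / t"])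
  qed
  moreover have "cfrac (map a [k..<Suc (k + Suc (Suc n))]) = a k + 1 / (a (Suc k) + 1 / c)"
    unfolding c_def add_Suc add_Suc_right cfrac_upt_Suc[of a "Suc k" n, unfolded add_Suc add_Suc_right, symmetric]
    by (rule cfrac_upt_Suc[of a k "Suc n", unfolded add_Suc add_Suc_right])
  moreover have "\<bar>x (Suc (Suc k)) - c\<bar> \<le> 2 / 2 ^ n"
    unfolding c_def by (rule ge2.IH(1)) (rule ge2.prems; simp)+
  moreover have "2 / 2 ^ Suc (Suc n) = (2 / 2 ^ n) / (4 :: real)" by simp
  moreover have "\<bar>1 / (a (Suc k) + 1 / x (Suc (Suc k))) - 1 / (a (Suc k) + 1 / c)\<bar> \<le> \<bar>x (Suc (Suc k)) - c\<bar> / 4"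
    using calculation(1-3) by (intro two_step_contraction)
  ultimately have "\<bar>x k - cfrac (map a [k..<Suc (k + Suc (Suc n))])\<bar> \<le> (2 / 2 ^ n) / 4"
    by (simp only: add_diff_cancel_left) (erule order_trans, rule divide_right_mono, assumption, simp)
  then show ?case by (simp only: \<open>2 / 2 ^ Suc (Suc n) = (2 / 2 ^ n) / (4 :: real)\<close>)
qed

text \<open>Position 0 is treated apart because \<open>a 0\<close> may be 0 and \<open>x 0\<close>
  below 1. Reciprocals of numbers >= 1 are no further apart than the numbers themselves, so the
  error bound from position 1 carries over.\<close>

lemma cfrac_tendsto:
  fixes a x :: "nat \<Rightarrow> real"
  assumes a: "\<And>j. 1 \<le> a (Suc j)" and x: "\<And>j. 1 \<le> x (Suc j)"
    and step: "\<And>j. x j = a j + 1 / x (Suc j)"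
  shows "(\<lambda>n. cfrac (map a [0..<Suc n])) \<longlonglongrightarrow> x 0"
proof -
  have a': "1 \<le> a j" and x': "1 \<le> x j" if "Suc 0 \<le> j" for j
    using a[of "j - 1"] x[of "j - 1"] that by auto
  have "\<bar>cfrac (map a [0..<Suc (Suc n)]) - x 0\<bar> \<le> 2 * (1 / 2) ^ n" for n
  proof -
    have diff: "1 / p - 1 / q = (q - p) / (p * q)" if "p \<noteq> 0" "q \<noteq> 0" for p q :: real
      using that by (simp add: field_simps)
    have shrink: "\<bar>y / z\<bar> \<le> \<bar>y\<bar>" if "1 \<le> z" for y z :: real
      using that mult_left_mono[of 1 z "\<bar>y\<bar>"] by (simp add: abs_divide divide_le_eq)
    define c where "c = cfrac (map a [Suc 0..<Suc (Suc 0 + n)])"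
    have c: "1 \<le> c" "1 \<le> x (Suc 0)" using cfrac_ge_1[of "Suc 0" a n, OF a'] x[of 0] by (simp_all only: c_def order_refl)
    have cx: "1 \<le> c * x (Suc 0)" using mult_mono[of 1 c 1 "x (Suc 0)"] c by simp
    have "cfrac (map a [0..<Suc (Suc n)]) = a 0 + 1 / c" using cfrac_upt_Suc[of a 0 n] by (simp only: c_def add_0)
    then have "\<bar>cfrac (map a [0..<Suc (Suc n)]) - x 0\<bar> = \<bar>1 / c - 1 / x (Suc 0)\<bar>"
      by (simp only: step[of 0] add_diff_cancel_left)
    moreover have "1 / c - 1 / x (Suc 0) = (x (Suc 0) - c) / (c * x (Suc 0))"
      by (rule diff) (use c in linarith)+
    moreover have "\<bar>x (Suc 0) - c\<bar> \<le> 2 / 2 ^ n"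
      unfolding c_def by (rule cfrac_error[of "Suc 0" a x n]) (simp_all only: a' x' step[symmetric])
    ultimately show ?thesis
      using shrink[OF cx, of "x (Suc 0) - c"] by (simp add: power_one_over del: upt_Suc)
  qed
  then have bound: "\<forall>\<^sub>F n in sequentially. norm (cfrac (map a [0..<Suc (Suc n)]) - x 0) \<le> 2 * (1 / 2) ^ n"
    unfolding real_norm_def by (intro always_eventually allI)
  have "(\<lambda>n. 2 * (1 / 2) ^ n :: real) \<longlonglongrightarrow> 2 * 0"
    by (intro tendsto_mult_left LIMSEQ_power_zero) auto
  then have "(\<lambda>n. cfrac (map a [0..<Suc (Suc n)]) - x 0) \<longlonglongrightarrow> 0"
    by (intro Lim_null_comparison[OF bound]) simp
  then have "(\<lambda>n. cfrac (map a [0..<Suc (Suc n)])) \<longlonglongrightarrow> x 0"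
    by (rule LIM_zero_cancel)
  then show ?thesis
    by (rule LIMSEQ_imp_Suc)
qed

section \<open>Polygonal arcs\<close>

lemma pathstart_polygonal_path: "vs \<noteq> [] \<Longrightarrow> pathstart (polygonal_path vs) = hd vs"
  by (induction vs rule: polygonal_path.induct) auto

lemma pathfinish_polygonal_path: "vs \<noteq> [] \<Longrightarrow> pathfinish (polygonal_path vs) = last vs"
  by (induction vs rule: polygonal_path.induct) auto

lemma joining_polygonal_line_segment:
  "a \<noteq> b \<Longrightarrow> joining_polygonal_line a b (closed_segment a b)"
  unfolding joining_polygonal_line_def by (intro exI[of _ "[a, b]"]) (auto simp: arc_linepath)

lemma joining_polygonal_line_Cons:
  assumes ab: "a \<noteq> b" and A: "joining_polygonal_line b c A" and inter: "closed_segment a b \<inter> A \<subseteq> {b}"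
  shows "joining_polygonal_line a c (closed_segment a b \<union> A)"
proof -
  obtain vs where vs: "vs \<noteq> []" "hd vs = b" "last vs = c" "arc (polygonal_path vs)"
    "A = path_image (polygonal_path vs)"
    using A unfolding joining_polygonal_line_def by blast
  \<comment> \<open>A one-point list gives a constant path, which is not an arc; with a second
    vertex the third equation of \<open>polygonal_path\<close> applies to
    \<open>a # vs\<close>.\<close>
  obtain b' vs' where vs': "vs = b # b' # vs'"
    using vs(1,2,4) by (cases vs rule: polygonal_path.cases) (auto dest: arc_distinct_ends)
  have start: "pathstart (polygonal_path (b # b' # vs')) = b"
    by (simp add: pathstart_polygonal_path)
  have "arc (polygonal_path (a # vs))"
    using vs(4) inter ab vs(5) start by (simp add: vs' arc_linepath arc_join)
  moreover have "path_image (polygonal_path (a # vs)) = closed_segment a b \<union> A"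
    using start by (simp add: vs' vs(5) path_image_join)
  ultimately show ?thesis
    unfolding joining_polygonal_line_def
    by (intro exI[of _ "a # vs"]) (auto simp: vs)
qed

lemma joining_polygonal_line_arc:
  assumes "joining_polygonal_line a b A"
  obtains g where "arc g" "pathstart g = a" "pathfinish g = b" "path_image g = A"
  using assms unfolding joining_polygonal_line_def
  by (metis pathstart_polygonal_path pathfinish_polygonal_path)

text \<open>The inverse of the parametrization maps \<open>R\<close> onto a connected subset of
  [0, 1] that contains 0 and 1, hence onto all of it.\<close>

lemma arc_eq_connected_subset:
  fixes g :: "real \<Rightarrow> 'a::real_normed_vector"
  assumes g: "arc g" and R: "connected R" "R \<subseteq> path_image g" "pathstart g \<in> R" "pathfinish g \<in> R"
  shows "R = path_image g"
proof -
  have cont: "continuous_on {0..1} g" and inj: "inj_on g {0..1}"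
    using g by (auto simp: arc_def path_def)
  obtain q where q: "homeomorphism {0..1} (path_image g) g q"
    using homeomorphism_compact[OF compact_Icc cont _ inj, of "path_image g"] by (auto simp: path_image_def)
  have "connected (q ` R)"
    using q R by (intro connected_continuous_image) (auto simp: homeomorphism_def elim: continuous_on_subset)
  moreover have "q (pathstart g) = 0" "q (pathfinish g) = 1"
    using q by (auto simp: homeomorphism_def pathstart_def pathfinish_def)
  then have "0 \<in> q ` R" "1 \<in> q ` R" using R by (metis imageI)+
  ultimately have "{0..1} \<subseteq> q ` R"
    by (meson atLeastAtMost_iff connectedD_interval subsetI)
  then have "g ` {0..1} \<subseteq> g ` q ` R" by (rule image_mono)
  also have "g ` q ` R \<subseteq> R"
    using q R(2) by (force simp: homeomorphism_def)
  finally show ?thesis using R(2) by (auto simp: path_image_def)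
qed

text \<open>
  A connected set joining \<open>a\<close> to \<open>c\<close> in the closed curve \<open>R \<union> L \<union> [a, b]\<close> and missing a point \<open>x\<close> of
  \<open>]a, b[\<close> cannot miss a point \<open>y\<close> of \<open>R\<close>, because \<open>x\<close> and \<open>y\<close> together separate \<open>a\<close> from \<open>c\<close>.
\<close>

lemma arc_in_closed_curve_unique:
  fixes a b c :: "'a::euclidean_space"
  assumes gR: "arc gR" "pathstart gR = a" "pathfinish gR = c" "path_image gR = R"
    and gL: "closed L" "c \<in> L"
    and RL: "R \<inter> L \<subseteq> {c}" and Rab: "R \<inter> closed_segment a b \<subseteq> {a}" and Lab: "L \<inter> closed_segment a b \<subseteq> {b}"
    and h: "arc h" "pathstart h = a" "pathfinish h = c" "path_image h \<subseteq> R \<union> L \<union> closed_segment a b"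
    and x: "x \<in> open_segment a b" "x \<notin> path_image h"
  shows "path_image h = R"
proof -
  have ac: "a \<noteq> c" using gR arc_distinct_ends by blast
  have ends: "a \<in> path_image h" "c \<in> path_image h" using h(2,3) pathstart_in_path_image pathfinish_in_path_image by metis+
  have "R \<subseteq> path_image h"
  proof (rule ccontr)
    assume "\<not> R \<subseteq> path_image h"
    then obtain y where "y \<in> path_image gR" "y \<notin> path_image h"
      using gR(4) by auto
    then obtain s where s: "0 \<le> s" "s \<le> 1" and y: "gR s \<notin> path_image h"
      unfolding path_image_def[of gR] by auto
    have cont: "continuous_on {0..1} gR" and inj: "inj_on gR {0..1}"
      using gR(1) by (auto simp: arc_def path_def)
    have g01: "gR 0 = a" "gR 1 = c" using gR by (auto simp: pathstart_def pathfinish_def)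
    \<comment> \<open>Cut the curve at \<open>gR s\<close> and \<open>x\<close>: \<open>X\<close> is
      the piece containing \<open>a\<close>, \<open>Y\<close> the piece containing \<open>c\<close>.
      They meet at most in these two points, both avoided by \<open>h\<close>.\<close>
    define X where "X = gR ` {0..s} \<union> closed_segment a x"
    define Y where "Y = gR ` {s..1} \<union> closed_segment x b \<union> L"
    have "compact (gR ` {0..s})" "compact (gR ` {s..1})"
      using s by (auto intro!: compact_continuous_image continuous_on_subset[OF cont])
    then have cl: "closed X" "closed Y"
      unfolding X_def Y_def using gL by (auto intro!: closed_Un dest: compact_imp_closed)
    have R: "R = gR ` {0..s} \<union> gR ` {s..1}"
      unfolding gR(4)[symmetric] path_image_def image_Un[symmetric] using s by (simp add: ivl_disj_un)
    have seg: "closed_segment a b = closed_segment a x \<union> closed_segment x b"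
      using x(1) Un_closed_segment open_closed_segment by metis
    have segI: "closed_segment a x \<inter> closed_segment x b = {x}"
      using x(1) Int_closed_segment open_closed_segment by (metis)
    have ax: "a \<notin> closed_segment x b" "b \<notin> closed_segment a x"
      using segI x(1) by (auto simp: open_segment_def)
    have gI: "z = gR s" if z: "z \<in> gR ` {0..s}" "z \<in> gR ` {s..1}" for z
    proof -
      obtain t where t: "t \<in> {0..s}" "z = gR t" using z(1) by blast
      obtain t' where t': "t' \<in> {s..1}" "z = gR t'" using z(2) by blast
      have "t = t'" using inj_onD[OF inj, of t t'] t t' s by simp
      then have "t = s" using t(1) t'(1) by simp
      then show ?thesis using t(2) by simp
    qed
    have gends: "a \<in> gR ` {0..s}" "c \<in> gR ` {s..1}"
      unfolding g01[symmetric] using s by (intro imageI; simp)+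
    have "X \<inter> Y \<subseteq> {gR s, x}"
    proof
      fix z assume z: "z \<in> X \<inter> Y"
      have z1: "z \<in> gR ` {0..s} \<or> z \<in> closed_segment a x" using z by (auto simp: X_def)
      have z2: "z \<in> gR ` {s..1} \<or> z \<in> closed_segment x b \<or> z \<in> L" using z by (auto simp: Y_def)
      have a1: "z = gR s" if "z = a" "z \<in> gR ` {s..1}"
        using gI gends that by simp
      have c1: "z = gR s" if "z = c" "z \<in> gR ` {0..s}"
        using gI gends that by simp
      have b1: False if "z = b" "z \<in> closed_segment a x" using ax that by simp
      have a2: False if "z = a" "z \<in> closed_segment x b" using ax that by simp
      have 1: "z = gR s" if "z \<in> gR ` {0..s}" "z \<in> gR ` {s..1}" using gI that by simp
      have 2: "z = x" if "z \<in> closed_segment a x" "z \<in> closed_segment x b" using segI that by blast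
      have 3: "z = a" if "z \<in> gR ` {0..s} \<or> z \<in> gR ` {s..1}" "z \<in> closed_segment a x \<or> z \<in> closed_segment x b"
        using Rab seg R that by blast
      have 4: "z = b" if "z \<in> L" "z \<in> closed_segment a x" using Lab seg that by blast
      have 5: "z = c" if "z \<in> L" "z \<in> gR ` {0..s}" using RL R that by blast
      show "z \<in> {gR s, x}"
      proof (cases "z \<in> gR ` {0..s}")
        case True
        then have "z = gR s" using z2 a2 c1 1 3 5 by metis
        then show ?thesis by simp
      next
        case False
        then have "z = gR s \<or> z = x" using z1 z2 a1 b1 2 3 4 by metis
        then show ?thesis by simp
      qed
    qed
    then have "X \<inter> Y \<inter> path_image h = {}" using x(2) y by auto
    moreover have "path_image h \<subseteq> X \<union> Y" using h(4) R seg by (auto simp: X_def Y_def)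
    moreover have "a \<in> X" "c \<in> Y" using gends by (auto simp: X_def Y_def)
    then have "X \<inter> path_image h \<noteq> {}" "Y \<inter> path_image h \<noteq> {}" using ends by auto
    ultimately show False
      using connected_arc_image[OF h(1)] cl unfolding connected_closed by blast
  qed
  \<comment> \<open>The roles are exchanged here: \<open>h\<close> is the arc, and \<open>R\<close>
    the connected subset containing its ends.\<close>
  moreover have "connected R" using gR connected_arc_image by blast
  moreover have "pathstart h \<in> R" "pathfinish h \<in> R"
    using h(2,3) gR pathstart_in_path_image[of gR] pathfinish_in_path_image[of gR] by simp_all
  ultimately show ?thesis
    using arc_eq_connected_subset[OF h(1)] by blast
qed


section \<open>Coordinates in the plane\<close>

lemma interior_move:
  fixes x :: "'a::real_normed_vector"
  assumes "x \<in> interior S"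
  obtains \<epsilon> where "0 < \<epsilon>" "x + \<epsilon> *\<^sub>R z \<in> S"
proof -
  obtain e where e: "0 < e" "ball x e \<subseteq> S" using assms by (auto simp: mem_interior)
  define \<epsilon> where "\<epsilon> = e / (2 * (norm z + 1))"
  have z: "0 < norm z + 1" by (smt (verit) norm_ge_zero)
  then have pos: "0 < \<epsilon>" using e by (simp add: \<epsilon>_def)
  have "\<epsilon> * norm z \<le> \<epsilon> * (norm z + 1)" using pos by (intro mult_left_mono) auto
  also have "\<dots> = e / 2" using z by (simp add: \<epsilon>_def field_simps)
  finally have "x + \<epsilon> *\<^sub>R z \<in> ball x e" using pos e(1) by (simp add: dist_norm)
  then show ?thesis using that pos e by blast
qed

text \<open>A small push along \<open>z\<close> stays in \<open>S\<close> but lowers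
  \<open>f\<close>. Each use supplies some convenient \<open>z\<close> on which \<open>f\<close> is
  negative.\<close>

lemma interior_halfspace_strict:
  fixes f :: "'a::real_normed_vector \<Rightarrow> real"
  assumes f: "linear f" and S: "S \<subseteq> {y. c \<le> f y}" and z: "f z < 0" and x: "x \<in> interior S"
  shows "c < f x"
proof -
  obtain \<epsilon> where e: "0 < \<epsilon>" "x + \<epsilon> *\<^sub>R z \<in> S" using interior_move[OF x, of z] by blast
  then have "c \<le> f x + \<epsilon> * f z" using S by (auto simp: linear_add[OF f] linear_cmul[OF f])
  moreover have "\<epsilon> * f z < 0" using e z by (simp add: mult_pos_neg)
  ultimately show ?thesis by linarith
qed

lemma convex_linear_ge:
  assumes "linear f"
  shows "convex {x. (c :: real) \<le> f x}"
proof -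
  have "{x. c \<le> f x} = f -` {c..}" by auto
  then show ?thesis using convex_linear_vimage[OF assms, of "{c..}"] by simp
qed

lemma Ints_pos_ge_1: "r \<in> \<int> \<Longrightarrow> 0 < r \<Longrightarrow> 1 \<le> (r :: real)"
  by (elim Ints_cases) simp

declare triangle.simps [simp del]

text \<open>The dimension enters only through \<open>expand\<close>. Keeping both coordinate
  functions as parameters turns the exchange of \<open>e1\<close> and \<open>e2\<close> into a
  second interpretation.\<close>

locale plane_coords =
  fixes e1 e2 :: "'a::euclidean_space" and c1 c2 :: "'a \<Rightarrow> real"
  assumes linear_c1: "linear c1" and linear_c2: "linear c2"
    and expand: "x = c1 x *\<^sub>R e1 + c2 x *\<^sub>R e2"
    and c1_e1 [simp]: "c1 e1 = 1" and c2_e1 [simp]: "c2 e1 = 0"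
    and c1_e2 [simp]: "c1 e2 = 0" and c2_e2 [simp]: "c2 e2 = 1"
begin

lemma coords_simps [simp]:
  "c1 (x + y) = c1 x + c1 y" "c2 (x + y) = c2 x + c2 y"
  "c1 (r *\<^sub>R x) = r * c1 x" "c2 (r *\<^sub>R x) = r * c2 x"
  "c1 0 = 0" "c2 0 = 0" "c1 (- x) = - c1 x" "c2 (- x) = - c2 x"
  by (simp_all add: linear_add linear_cmul linear_0 linear_neg linear_c1 linear_c2)

lemma coords_eqI: "c1 x = c1 y \<Longrightarrow> c2 x = c2 y \<Longrightarrow> x = y"
  using expand[of x] expand[of y] by simp

definition D :: "'a \<Rightarrow> 'a \<Rightarrow> real" where
  "D x y = c1 x * c2 y - c2 x * c1 y"

lemma D_simps [simp]:
  "D (x + y) z = D x z + D y z" "D x (y + z) = D x y + D x z"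
  "D (r *\<^sub>R x) y = r * D x y" "D x (r *\<^sub>R y) = r * D x y"
  "D x x = 0" "D 0 x = 0" "D x 0 = 0" "D (- x) y = - D x y" "D x (- y) = - D x y"
  "D e1 x = c2 x" "D x e2 = c1 x" "D x e1 = - c2 x" "D e2 x = - c1 x"
  by (simp_all add: D_def algebra_simps)

lemma D_anti: "D x y = - D y x"
  by (simp add: D_def)

text \<open>Cramer's rule in the basis \<open>(u, v)\<close>. Petals are handled throughout by the
  coordinates \<open>D x v\<close> and \<open>D u x\<close>.\<close>

lemma D_expand: "D u v = 1 \<Longrightarrow> x = D x v *\<^sub>R u + D u x *\<^sub>R v"
proof (rule coords_eqI)
  assume uv: "D u v = 1"
  have "D x v * c1 u + D u x * c1 v = D u v * c1 x" "D x v * c2 u + D u x * c2 v = D u v * c2 x"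
    by (simp_all add: D_def algebra_simps)
  then show "c1 x = c1 (D x v *\<^sub>R u + D u x *\<^sub>R v)" "c2 x = c2 (D x v *\<^sub>R u + D u x *\<^sub>R v)"
    using uv by simp_all
qed

lemma linear_D: "linear (D x)" "linear (\<lambda>x. D x y)"
  by (simp_all add: linear_iff)

lemma continuous_on_D [continuous_intros]: "continuous_on S (D x)" "continuous_on S (\<lambda>x. D x y)"
  by (simp_all add: linear_continuous_on linear_conv_bounded_linear[symmetric] linear_D)

lemma continuous_on_coords [continuous_intros]: "continuous_on S c1" "continuous_on S c2"
  by (simp_all add: linear_continuous_on linear_conv_bounded_linear[symmetric] linear_c1 linear_c2)

definition lattice :: "'a set" where
  "lattice = {x. c1 x \<in> \<int> \<and> c2 x \<in> \<int>}"

lemma D_lattice: "x \<in> lattice \<Longrightarrow> y \<in> lattice \<Longrightarrow> D x y \<in> \<int>"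
  by (simp add: lattice_def D_def)

text \<open>In the coordinates p = \<open>D x v\<close> and q = \<open>D u x\<close> a petal is the
  half of the unit square beyond the diagonal p + q = 1; the barycentric weights at
  \<open>u\<close>, \<open>v\<close>, \<open>u + v\<close> are 1 - q, 1 - p, p + q - 1.\<close>

lemma triangle_eq:
  assumes uv: "D u v = 1"
  shows "triangle (u, v) = {x. D x v \<le> 1 \<and> D u x \<le> 1 \<and> 1 \<le> D x v + D u x}"
proof safe
  fix x assume "x \<in> triangle (u, v)"
  then obtain p q r where pqr: "0 \<le> p" "0 \<le> q" "0 \<le> r" "p + q + r = 1" and x: "x = p *\<^sub>R u + q *\<^sub>R v + r *\<^sub>R (u + v)"
    by (auto simp: triangle.simps convex_hull_3)
  have "D x v = p + r" "D u x = q + r" using uv by (simp_all add: x)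
  then show "D x v \<le> 1" "D u x \<le> 1" "1 \<le> D x v + D u x" using pqr by simp_all
next
  fix x assume x: "D x v \<le> 1" "D u x \<le> 1" "1 \<le> D x v + D u x"
  have "x = D x v *\<^sub>R u + D u x *\<^sub>R v" by (rule D_expand[OF uv])
  also have "\<dots> = (1 - D u x) *\<^sub>R u + (1 - D x v) *\<^sub>R v + (D x v + D u x - 1) *\<^sub>R (u + v)"
    by (simp add: algebra_simps)
  finally show "x \<in> triangle (u, v)"
    unfolding triangle.simps convex_hull_3 mem_Collect_eq
    using x by (intro exI[of _ "1 - D u x"] exI[of _ "1 - D x v"] exI[of _ "D x v + D u x - 1"]) auto
qed

lemma interior_triangle:
  assumes uv: "D u v = 1"
  shows "interior (triangle (u, v)) = {x. D x v < 1 \<and> D u x < 1 \<and> 1 < D x v + D u x}" (is "_ = ?O")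
proof
  have vu: "D v u = -1" using uv by (subst D_anti) simp
  show "interior (triangle (u, v)) \<subseteq> ?O"
  proof safe
    fix x assume x: "x \<in> interior (triangle (u, v))"
    have "- 1 < - D x v"
      by (rule interior_halfspace_strict[OF _ _ _ x, where z = u])
        (use uv in \<open>auto simp: linear_iff triangle_eq algebra_simps\<close>)
    then show "D x v < 1" by simp
    have "- 1 < - D u x"
      by (rule interior_halfspace_strict[OF _ _ _ x, where z = v])
        (use uv in \<open>auto simp: linear_iff triangle_eq algebra_simps\<close>)
    then show "D u x < 1" by simp
    show "1 < D x v + D u x"
      by (rule interior_halfspace_strict[OF _ _ _ x, where z = "- u"])
        (use uv in \<open>auto simp: linear_iff triangle_eq algebra_simps\<close>)
  qed
  show "?O \<subseteq> interior (triangle (u, v))"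
  proof (rule interior_maximal)
    show "open ?O"
      by (intro open_Collect_conj open_Collect_less continuous_intros)
  qed (auto simp: triangle_eq[OF uv])
qed

lemma compact_triangle: "compact (triangle (p :: 'a \<times> 'a))"
  by (cases p) (simp add: triangle.simps finite_imp_compact_convex_hull)

lemma lotus_basis:
  "(u, v) \<in> lotus e1 e2 \<Longrightarrow> D u v = 1"
  by (induction u v rule: lotus.induct) simp_all

lemma lotus_coords:
  "(u, v) \<in> lotus e1 e2 \<Longrightarrow>
     u \<in> lattice \<and> v \<in> lattice \<and> 1 \<le> c1 u \<and> 0 \<le> c2 u \<and> 0 \<le> c1 v \<and> 1 \<le> c2 v"
  by (induction u v rule: lotus.induct) (auto simp: lattice_def)

end

lemma lotus_swap: "(u, v) \<in> lotus e1 e2 \<Longrightarrow> (v, u) \<in> lotus e2 e1"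
proof (induction u v rule: lotus.induct)
  case (right u v)
  then show ?case using lotus.left[of v u e2 e1] by (simp add: add.commute)
next
  case (left u v)
  then show ?case using lotus.right[of v u e2 e1] by (simp add: add.commute)
qed (rule lotus.start)

section \<open>The petals met by a half-line\<close>

locale ray_in_cone = plane_coords +
  fixes w :: 'a
  assumes w_pos: "0 < c1 w" "0 < c2 w"
begin

definition ray :: "'a set" where
  "ray = {t *\<^sub>R w | t. 0 \<le> t}"

definition petals :: "('a \<times> 'a) set" where
  "petals = {(u, v). (u, v) \<in> lotus e1 e2 \<and> 0 < D w v \<and> 0 < D u w}"

lemma w_neq_0: "w \<noteq> 0"
  using w_pos by auto

lemma sheath_petals_eq: "sheath_petals e1 e2 ray = petals"
proof -
  have "interior (triangle (u, v)) \<inter> ray \<noteq> {} \<longleftrightarrow> 0 < D w v \<and> 0 < D u w"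
    if uv: "D u v = 1" for u v
  proof
    assume "interior (triangle (u, v)) \<inter> ray \<noteq> {}"
    then obtain t where t: "0 \<le> t" "t * D w v < 1" "t * D u w < 1" "1 < t * D w v + t * D u w"
      by (auto simp: interior_triangle[OF uv] ray_def)
    then have "0 < t * D w v" "0 < t * D u w" by linarith+
    then show "0 < D w v \<and> 0 < D u w" using t(1) by (simp add: zero_less_mult_iff)
  next
    assume pos: "0 < D w v \<and> 0 < D u w"
    \<comment> \<open>The point \<open>t *\<^sub>R w\<close> is in the open petal iff
      \<open>1 / (D w v + D u w) < t < 1 / m\<close>; this range is nonempty because the smaller
      coordinate of \<open>w\<close> is positive.\<close>
    define m where "m = max (D w v) (D u w)"
    have m: "0 < m" "D w v \<le> m" "D u w \<le> m" "m < D w v + D u w" using pos by (auto simp: m_def)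
    then have "1 / (D w v + D u w) < 1 / m" using pos by (intro divide_strict_left_mono) auto
    then obtain t where t: "1 / (D w v + D u w) < t" "t < 1 / m" using dense by blast
    have t0: "0 < t" using t(1) pos by (meson add_pos_pos less_trans zero_less_divide_1_iff)
    have "t * m < 1" using t(2) m(1) by (simp add: field_simps)
    moreover have "t * D w v \<le> t * m" "t * D u w \<le> t * m"
      using m t0 by (auto intro: mult_left_mono simp del: mult_le_cancel_left_pos)
    ultimately have "t * D w v < 1" "t * D u w < 1" by linarith+
    moreover have "1 < t * D w v + t * D u w"
      using t(1) pos by (simp add: divide_less_eq distrib_left)
    ultimately have "t *\<^sub>R w \<in> interior (triangle (u, v)) \<inter> ray"
      using t0 by (auto simp: interior_triangle[OF uv] ray_def)
    then show "interior (triangle (u, v)) \<inter> ray \<noteq> {}" by blast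
  qed
  then show ?thesis
    unfolding sheath_petals_def petals_def using lotus_basis by fast
qed

text \<open>The half-line enters through the base, where the two coordinates add up to 1.\<close>

lemma entry_distance:
  assumes "(u, v) \<in> petals"
  shows "infdist 0 (ray \<inter> triangle (u, v)) = norm w / (D w v + D u w)"
proof -
  have uv: "D u v = 1" and pos: "0 < D w v" "0 < D u w" using assms lotus_basis by (auto simp: petals_def)
  define t where "t = 1 / (D w v + D u w)"
  have t: "0 < t" "t * D w v \<le> 1" "t * D u w \<le> 1" "t * D w v + t * D u w = 1"
  proof -
    show "0 < t" using pos by (simp add: t_def)
    have "t * (D w v + D u w) = 1" using pos by (simp add: t_def)
    then show "t * D w v + t * D u w = 1" by (simp add: distrib_left)
    moreover have "0 < t * D w v" "0 < t * D u w" using pos \<open>0 < t\<close> by simp_all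
    ultimately show "t * D w v \<le> 1" "t * D u w \<le> 1" by linarith+
  qed
  have mem: "t *\<^sub>R w \<in> ray \<inter> triangle (u, v)" using t by (auto simp: triangle_eq[OF uv] ray_def)
  have "infdist 0 (ray \<inter> triangle (u, v)) = (INF x\<in>ray \<inter> triangle (u, v). dist 0 x)"
    using mem by (intro infdist_notempty) blast
  also have "\<dots> = t * norm w"
  proof (rule cInf_eq_minimum)
    show "t * norm w \<in> dist 0 ` (ray \<inter> triangle (u, v))" using mem t by (force intro!: image_eqI[of _ _ "t *\<^sub>R w"])
    fix d assume "d \<in> dist 0 ` (ray \<inter> triangle (u, v))"
    then obtain s where s: "0 \<le> s" "1 \<le> s * D w v + s * D u w" "d = s * norm w"
      by (auto simp: triangle_eq[OF uv] ray_def)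
    then have "t \<le> s" using pos by (simp add: t_def divide_le_eq distrib_left)
    then show "t * norm w \<le> d" using s by (simp add: mult_right_mono)
  qed
  finally show ?thesis by (simp add: t_def)
qed

text \<open>
  The subtractive Euclidean algorithm on the coordinates \<open>A i\<close>, \<open>B i\<close> of \<open>w\<close> in the basis \<open>chain i\<close>.
  It also runs on after \<open>A i\<close> has become \<open>0\<close>; the petals of the sheath are those with \<open>0 < A i\<close>.
\<close>

primrec chain :: "nat \<Rightarrow> 'a \<times> 'a" where
  "chain 0 = (e1, e2)"
| "chain (Suc i) = (case chain i of (u, v) \<Rightarrow> if D u w \<le> D w v then (u, u + v) else (u + v, v))"

definition U :: "nat \<Rightarrow> 'a" where "U i = fst (chain i)"
definition V :: "nat \<Rightarrow> 'a" where "V i = snd (chain i)"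
definition A :: "nat \<Rightarrow> real" where "A i = D w (V i)"
definition B :: "nat \<Rightarrow> real" where "B i = D (U i) w"

lemma chain_UV: "chain i = (U i, V i)"
  by (simp add: U_def V_def)

lemma chain_0 [simp]: "U 0 = e1" "V 0 = e2" "A 0 = c1 w" "B 0 = c2 w"
  by (simp_all add: U_def V_def A_def B_def)

lemma D_V_w: "D (V i) w = - A i" and D_w_U: "D w (U i) = - B i"
  by (simp_all add: A_def B_def D_anti[of "V i"] D_anti[of w "U i"])

lemma step_right:
  assumes "B i \<le> A i"
  shows "U (Suc i) = U i" "V (Suc i) = U i + V i" "A (Suc i) = A i - B i" "B (Suc i) = B i"
proof -
  show U: "U (Suc i) = U i" and V: "V (Suc i) = U i + V i"
    unfolding U_def[of "Suc i"] V_def[of "Suc i"]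
    using assms by (simp_all add: chain_UV[of i] A_def B_def)
  show "A (Suc i) = A i - B i" "B (Suc i) = B i"
    using U V D_w_U by (simp_all add: A_def B_def)
qed

lemma step_left:
  assumes "A i < B i"
  shows "U (Suc i) = U i + V i" "V (Suc i) = V i" "A (Suc i) = A i" "B (Suc i) = B i - A i"
proof -
  show U: "U (Suc i) = U i + V i" and V: "V (Suc i) = V i"
    unfolding U_def[of "Suc i"] V_def[of "Suc i"]
    using assms by (simp_all add: chain_UV[of i] A_def B_def)
  show "A (Suc i) = A i" "B (Suc i) = B i - A i"
    using U V D_V_w by (simp_all add: A_def B_def)
qed

text \<open>A tie is treated as a right step, so only \<open>A\<close> can reach 0. Hence
  \<open>0 < A i\<close> alone says that \<open>w\<close> is strictly inside the cone over the base
  of petal \<open>i\<close>.\<close>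

lemma B_pos: "0 < B i"
proof -
  have "0 \<le> A i \<and> 0 < B i"
  proof (induction i)
    case 0
    then show ?case using w_pos by simp
  next
    case (Suc i)
    then show ?case by (cases "B i \<le> A i") (auto simp: step_right step_left not_le)
  qed
  then show ?thesis by simp
qed

lemma chain_lotus: "(U i, V i) \<in> lotus e1 e2"
proof (induction i)
  case 0
  then show ?case by (simp add: lotus.start)
next
  case (Suc i)
  then show ?case by (cases "B i \<le> A i") (auto simp: step_right step_left not_le intro: lotus.intros)
qed

lemmas UV [simp] = lotus_basis[OF chain_lotus]
lemmas UV_coords = lotus_coords[OF chain_lotus]

lemma VU [simp]: "D (V i) (U i) = - 1"
  by (subst D_anti) simp

lemma A_antimono: "i \<le> j \<Longrightarrow> A j \<le> A i"
proof (induction j rule: dec_induct)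
  case (step j)
  have "A (Suc j) \<le> A j"
    using B_pos[of j] by (cases "B j \<le> A j") (auto simp: step_right step_left not_le)
  then show ?case using step by simp
qed simp

lemma live_down: "0 < A j \<Longrightarrow> i \<le> j \<Longrightarrow> 0 < A i"
  using A_antimono by (meson less_le_trans)

text \<open>If \<open>l\<close> meets a petal, the positive coordinates of \<open>w\<close> there
  force a strict inequality between its coordinates in the parent. So the parent is met too, and the
  algorithm takes the same branch.\<close>

lemma petals_eq: "petals = chain ` {i. 0 < A i}"
proof
  have "0 < D w v \<longrightarrow> 0 < D u w \<longrightarrow> (\<exists>i. chain i = (u, v))" if "(u, v) \<in> lotus e1 e2" for u v
    using that
  proof (induction u v rule: lotus.induct)
    case start
    then show ?case by (metis chain.simps(1))
  next
    case (right u v)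
    show ?case
    proof (intro impI)
      assume pos: "0 < D w (u + v)" "0 < D u w"
      then have le: "D u w < D w v" using D_anti[of w u] by simp
      then obtain i where "chain i = (u, v)" using right.IH pos by auto
      then have "chain (Suc i) = (u, u + v)" using le by simp
      then show "\<exists>i. chain i = (u, u + v)" by blast
    qed
  next
    case (left u v)
    show ?case
    proof (intro impI)
      assume pos: "0 < D w v" "0 < D (u + v) w"
      then have le: "D w v < D u w" using D_anti[of v w] by simp
      then obtain i where "chain i = (u, v)" using left.IH pos by auto
      then have "chain (Suc i) = (u + v, v)" using le by simp
      then show "\<exists>i. chain i = (u + v, v)" by blast
    qed
  qed
  then have "\<exists>i. chain i = p \<and> 0 < A i" if "p \<in> petals" for p
    using that by (cases p) (fastforce simp: petals_def A_def V_def)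
  then show "petals \<subseteq> chain ` {i. 0 < A i}" by blast
  show "chain ` {i. 0 < A i} \<subseteq> petals"
    using B_pos chain_lotus by (auto simp: petals_def chain_UV A_def B_def)
qed

text \<open>Archimedes: uninterrupted right turns would subtract the constant \<open>B i\<close>
  from \<open>A\<close> for ever. Up to the first other index \<open>U\<close> has not moved, so an
  edge of the right boundary (possibly the one at the tie) starts at \<open>U i\<close>.\<close>

lemma ex_left_turn:
  assumes "0 < A i"
  obtains j where "i \<le> j" "0 < A j" "A j \<le> B j" "U j = U i"
proof (rule ccontr)
  assume no: "\<not> thesis"
  have run: "0 < A (i + k) \<and> U (i + k) = U i \<and> B (i + k) = B i \<and> A (i + k) = A i - real k * B i" for k
  proof (induction k)
    case (Suc k)
    then have "B (i + k) < A (i + k)" using no that[of "i + k"] by fastforce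
    then show ?case using Suc by (auto simp: step_right algebra_simps)
  qed (use assms in simp)
  obtain k where "A i < real k * B i" using ex_less_of_nat_mult[OF B_pos] by blast
  then show False using run[of k] by auto
qed

lemma ex_right_turn:
  assumes "0 < A i"
  obtains j where "i \<le> j" "0 < A j" "B j \<le> A j" "V j = V i"
proof (rule ccontr)
  assume no: "\<not> thesis"
  have run: "V (i + k) = V i \<and> A (i + k) = A i \<and> B (i + k) = B i - real k * A i" for k
  proof (induction k)
    case (Suc k)
    then have "A (i + k) < B (i + k)" using no that[of "i + k"] assms by fastforce
    then show ?case using Suc by (auto simp: step_left algebra_simps)
  qed simp
  obtain k where "B i < real k * A i" using ex_less_of_nat_mult[OF assms] by blast
  then show False using run[of k] B_pos[of "i + k"] by auto
qed

section \<open>Growth of the vertices along the sheath\<close>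

definition height :: "'a \<Rightarrow> real" where "height x = c1 x + c2 x"

lemma height_simps [simp]:
  "height (x + y) = height x + height y" "height (r *\<^sub>R x) = r * height x"
  by (simp_all add: height_def algebra_simps)

lemma height_UV: "1 \<le> height (U i)" "1 \<le> height (V i)"
  using UV_coords[of i] by (auto simp: height_def)

lemma height_mono: "i \<le> j \<Longrightarrow> height (U i) \<le> height (U j) \<and> height (V i) \<le> height (V j)"
proof (induction j rule: dec_induct)
  case (step j)
  then show ?case
    using height_UV[of j] by (cases "B j \<le> A j") (auto simp: step_right step_left not_le)
qed simp

text \<open>In an endless algorithm there is no tie, and turns of both kinds recur. Each left turn
  adds \<open>height (V j) \<ge> 1\<close> to the height of \<open>U\<close>, each right turn does
  the same for \<open>V\<close>.\<close>

lemma height_unbounded: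
  assumes live: "\<And>i. 0 < A i"
  obtains i where "\<And>j. i \<le> j \<Longrightarrow> r \<le> height (U j) \<and> r \<le> height (V j)"
proof -
  have U: "\<exists>i. real n \<le> height (U i)" for n
  proof (induction n)
    case 0
    then show ?case using height_UV by (intro exI[of _ 0]) (smt (verit) of_nat_0)
  next
    case (Suc n)
    then obtain i where i: "real n \<le> height (U i)" by blast
    obtain j where j: "i \<le> j" "A j \<le> B j" "U j = U i" using ex_left_turn[OF live] by blast
    have "A j \<noteq> B j" using step_right(3)[of j] live[of "Suc j"] by auto
    then have "U (Suc j) = U j + V j" using j by (simp add: step_left)
    then have "real (Suc n) \<le> height (U (Suc j))" using i j height_UV[of j] by simp
    then show ?case by blast
  qed
  have V: "\<exists>i. real n \<le> height (V i)" for n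
  proof (induction n)
    case 0
    then show ?case using height_UV by (intro exI[of _ 0]) (smt (verit) of_nat_0)
  next
    case (Suc n)
    then obtain i where i: "real n \<le> height (V i)" by blast
    obtain j where j: "i \<le> j" "B j \<le> A j" "V j = V i" using ex_right_turn[OF live] by blast
    then have "V (Suc j) = U j + V j" by (simp add: step_right)
    then have "real (Suc n) \<le> height (V (Suc j))" using i j height_UV[of j] by simp
    then show ?case by blast
  qed
  obtain n where n: "r \<le> real n" using real_arch_simple by blast
  obtain i where i: "real n \<le> height (U i)" using U by blast
  obtain j where j: "real n \<le> height (V j)" using V by blast
  have "r \<le> height (U k) \<and> r \<le> height (V k)" if "max i j \<le> k" for k
    using height_mono[of i k] height_mono[of j k] that i j n by auto
  then show ?thesis using that by blast
qed


section \<open>The convex hull of the lattice points on one side\<close>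

definition cone1 :: "'a set" where
  "cone1 = {x. 0 \<le> c2 x \<and> 0 \<le> D x w}"

definition K :: "'a set" where
  "K = convex hull {x \<in> lattice. x \<noteq> 0 \<and> x \<in> cone1}"

text \<open>Phrased with petals, not with the indices of \<open>chain\<close>, whose treatment of
  ties is not symmetric; so exchanging \<open>e1\<close> and \<open>e2\<close> yields exactly
  \<open>left_line\<close>. The petal of a tie contributes to both lines.\<close>

definition right_line :: "'a set" where
  "right_line = (\<Union>(u, v) \<in> {(u, v). (u, v) \<in> petals \<and> D w v \<le> D u w}. closed_segment u (u + v))"

lemma right_line_eq: "right_line = (\<Union>i \<in> {i. 0 < A i \<and> A i \<le> B i}. closed_segment (U i) (U i + V i))"
proof -
  have "{(u, v). (u, v) \<in> petals \<and> D w v \<le> D u w} = chain ` {i. 0 < A i \<and> A i \<le> B i}"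
    by (auto simp: petals_eq chain_UV A_def B_def)
  then show ?thesis by (simp only: right_line_def) (simp add: chain_UV)
qed

lemma cone1_D_V:
  assumes x: "x \<in> cone1" "x \<noteq> 0" and i: "0 < A i"
  shows "0 < D x (V i)"
proof -
  \<comment> \<open>The three-term Pluecker relation for \<open>e1\<close>, \<open>x\<close>,
    \<open>w\<close>, \<open>V i\<close>, where \<open>c2\<close> is \<open>D e1\<close>.\<close>
  have plucker: "c2 w * D x (V i) = D x w * c2 (V i) + c2 x * A i"
    by (simp add: D_def A_def algebra_simps)
  have nonneg: "0 \<le> c2 x" "0 \<le> D x w" using x by (auto simp: cone1_def)
  have "c2 x \<noteq> 0 \<or> D x w \<noteq> 0"
    using x w_pos coords_eqI[of x 0] by (auto simp: D_def)
  then have "0 < D x w * c2 (V i) + c2 x * A i"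
    using nonneg UV_coords[of i] i
    by (metis add_nonneg_pos add_pos_nonneg less_eq_real_def mult_nonneg_nonneg mult_pos_pos order_less_le_trans zero_less_one)
  then show ?thesis
    unfolding plucker[symmetric] using w_pos by (simp add: zero_less_mult_iff)
qed

text \<open>The hull as an intersection of half-planes. Once \<open>K_eq_M\<close> is proved,
  closedness and supporting lines of the hull can be read off.\<close>

definition M :: "'a set" where
  "M = {x. x \<in> cone1 \<and> (\<forall>i. 0 < A i \<longrightarrow> 1 \<le> D x (V i))}"

lemma convex_M: "convex M"
proof -
  have "M = {x. 0 \<le> c2 x} \<inter> {x. 0 \<le> D x w} \<inter> (\<Inter>i \<in> {i. 0 < A i}. {x. 1 \<le> D x (V i)})"
    by (auto simp: M_def cone1_def)
  then show ?thesis
    by (simp add: convex_Int convex_INT convex_linear_ge linear_c2 linear_D)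
qed

lemma K_subset_M: "K \<subseteq> M"
  unfolding K_def
proof (rule hull_minimal)
  have "1 \<le> D x (V i)" if "x \<in> lattice" "x \<noteq> 0" "x \<in> cone1" "0 < A i" for x i
    using that cone1_D_V D_lattice UV_coords Ints_pos_ge_1 by blast
  then show "{x \<in> lattice. x \<noteq> 0 \<and> x \<in> cone1} \<subseteq> M" by (auto simp: M_def)
qed (rule convex_M)

lemma K_lattice: "x \<in> lattice \<Longrightarrow> x \<noteq> 0 \<Longrightarrow> x \<in> cone1 \<Longrightarrow> x \<in> K"
  unfolding K_def by (rule hull_inc) simp

text \<open>Multiplication by a positive integer \<open>n\<close> maps the lattice points of the
  cone into themselves, hence \<open>K\<close> into \<open>K\<close>; for real \<open>s\<close> take
  \<open>n \<ge> s\<close> and use that \<open>s *\<^sub>R x\<close> lies between \<open>x\<close>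
  and \<open>n x\<close>.\<close>

lemma K_scale:
  assumes x: "x \<in> K" and s: "1 \<le> s"
  shows "s *\<^sub>R x \<in> K"
proof -
  obtain n :: nat where n: "s \<le> real n" using real_arch_simple by blast
  have n0: "1 \<le> real n" "n \<noteq> 0" using s n by (auto intro: ccontr)
  let ?L = "{x \<in> lattice. x \<noteq> 0 \<and> x \<in> cone1}"
  have "(*\<^sub>R) (real n) ` ?L \<subseteq> ?L" using n0 by (auto simp: lattice_def cone1_def)
  then have "(*\<^sub>R) (real n) ` K \<subseteq> K"
    unfolding K_def convex_hull_scaling[symmetric] by (rule hull_mono)
  then have nx: "real n *\<^sub>R x \<in> K" using x by blast
  show ?thesis
  proof (cases "real n = 1")
    case True
    then show ?thesis using s n x by simp
  next
    case False
    define m where "m = real n"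
    define t where "t = (s - 1) / (m - 1)"
    have m: "1 < m" "s \<le> m" using False n0 n by (auto simp: m_def)
    then have "t * (m - 1) = s - 1" by (simp add: t_def)
    moreover have "0 \<le> t" "t \<le> 1" using m s by (auto simp: t_def)
    ultimately have t: "0 \<le> t" "t \<le> 1" "(1 - t) + t * real n = s"
      by (auto simp: m_def algebra_simps)
    have "s *\<^sub>R x = (1 - t) *\<^sub>R x + t *\<^sub>R (real n *\<^sub>R x)"
      unfolding t(3)[symmetric] by (simp add: scaleR_add_left)
    also have "\<dots> \<in> K"
      using t x nx convex_convex_hull unfolding K_def by (intro convexD_alt) auto
    finally show ?thesis .
  qed
qed

lemma U_in_K: "U i \<in> K"
  using UV_coords[of i] B_pos[of i] by (intro K_lattice) (auto simp: cone1_def B_def)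

lemma UV_in_K: "A i \<le> B i \<Longrightarrow> U i + V i \<in> K"
  using UV_coords[of i] D_V_w[of i] by (intro K_lattice) (auto simp: cone1_def lattice_def B_def dest: arg_cong[of _ _ c1])

lemma right_line_subset_K: "right_line \<subseteq> K"
  using U_in_K UV_in_K convex_convex_hull[of "{x \<in> lattice. x \<noteq> 0 \<and> x \<in> cone1}"]
  unfolding right_line_eq K_def[symmetric] by (auto dest: closed_segment_subset)

text \<open>\<open>U\<close> moves only at left turns, where it becomes \<open>U + V\<close>. So it
  can pass \<open>x\<close> only if some earlier edge end \<open>U j + V j\<close> has reached
  \<open>x\<close>; at index 0 the claim is \<open>0 \<le> c2 x\<close>.\<close>

lemma U_sees:
  assumes x: "x \<in> cone1" and no: "\<And>j. j < i \<Longrightarrow> 0 < A j \<Longrightarrow> A j \<le> B j \<Longrightarrow> 0 < D (U j + V j) x"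
    and i: "0 < A i"
  shows "0 \<le> D (U i) x"
  using no i
proof (induction i)
  case 0
  then show ?case using x by (simp add: cone1_def)
next
  case (Suc i)
  have live: "0 < A i" using live_down[OF Suc.prems(2)] by simp
  have "0 < D (U i + V i) x" if "A i \<le> B i" by (rule Suc.prems(1)) (use live that in simp_all)
  then show ?case
    using Suc.IH[OF Suc.prems(1) live] by (cases "B i \<le> A i") (auto simp: step_right step_left not_le)
qed

text \<open>A step without a tie leaves both coordinates positive, so only a tie can end the
  algorithm.\<close>

lemma tie_or_live: "(\<forall>i. 0 < A i) \<or> (\<exists>n. 0 < A n \<and> A n = B n)"
proof (rule disjCI)
  assume no: "\<not> (\<exists>n. 0 < A n \<and> A n = B n)"
  have "0 < A i" for i
  proof (induction i)
    case 0
    then show ?case using w_pos by simp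
  next
    case (Suc i)
    moreover have "A i \<noteq> B i" using no Suc by blast
    ultimately show ?case by (cases "B i \<le> A i") (auto simp: step_right step_left not_le)
  qed
  then show "\<forall>i. 0 < A i" by blast
qed

lemma tie_unique:
  assumes n: "0 < A n" "A n = B n"
  shows "0 < A i \<longleftrightarrow> i \<le> n"
proof
  assume i: "0 < A i"
  have "A (Suc n) = 0" using n by (simp add: step_right)
  then show "i \<le> n" using live_down[OF i, of "Suc n"] by (cases "i \<le> n") auto
qed (use live_down n in blast)

text \<open>Take the first edge whose far end has reached \<open>x\<close>. With a tie the last edge
  ends on \<open>l\<close>, so one exists. Without a tie, if none existed, \<open>U_sees\<close> and
  \<open>D x (V i) \<ge> 1\<close> would give \<open>height x \<ge> height (U i)\<close> for all
  \<open>i\<close>; this also keeps the points of \<open>l\<close> itself out of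
  \<open>M\<close>.\<close>

lemma M_sector:
  assumes x: "x \<in> M"
  obtains i where "0 < A i" "A i \<le> B i" "0 \<le> D (U i) x" "D (U i + V i) x \<le> 0"
proof -
  have cone: "x \<in> cone1" and ge: "\<And>i. 0 < A i \<Longrightarrow> 1 \<le> D x (V i)" using x by (auto simp: M_def)
  define P where "P i \<longleftrightarrow> 0 < A i \<and> A i \<le> B i \<and> D (U i + V i) x \<le> 0" for i
  have "\<exists>i. P i"
    using tie_or_live
  proof
    assume live: "\<forall>i. 0 < A i"
    show ?thesis
    proof (rule ccontr)
      assume "\<nexists>i. P i"
      then have "0 < D (U j + V j) x" if "A j \<le> B j" for j
        using live that unfolding P_def by (meson not_le)
      then have pos: "0 \<le> D (U i) x" for i
        using live by (intro U_sees[OF cone]) simp_all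
      obtain i where i: "height x + 1 \<le> height (U i)" using height_unbounded[of "height x + 1"] live by blast
      have "height x = D x (V i) * height (U i) + D (U i) x * height (V i)"
        using arg_cong[OF D_expand[OF UV[of i], of x], of height] by simp
      moreover have "height (U i) \<le> D x (V i) * height (U i)"
        using ge[of i] live height_UV[of i] by simp
      moreover have "0 \<le> D (U i) x * height (V i)" using pos[of i] height_UV[of i] by simp
      ultimately show False using i by linarith
    qed
  next
    assume "\<exists>n. 0 < A n \<and> A n = B n"
    then obtain n where n: "0 < A n" "A n = B n" by blast
    have "w = A n *\<^sub>R (U n + V n)"
      using D_expand[OF UV[of n], of w] n by (simp add: A_def B_def scaleR_add_right)
    then have "D x w = A n * D x (U n + V n)" by (metis D_simps(4))
    then have "0 \<le> D x (U n + V n)" using cone n by (simp add: cone1_def zero_le_mult_iff)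
    then have "P n" using n D_anti[of x "U n + V n"] by (simp add: P_def)
    then show ?thesis by blast
  qed
  then obtain i where i: "P i" and least: "\<And>j. j < i \<Longrightarrow> \<not> P j"
    using exists_least_iff[of P] by blast
  have "0 < D (U j + V j) x" if "j < i" "0 < A j" "A j \<le> B j" for j
    using least[OF that(1)] that unfolding P_def by (meson not_le)
  then have "0 \<le> D (U i) x"
    using i by (intro U_sees[OF cone]) (simp_all add: P_def)
  then show ?thesis using that i by (auto simp: P_def)
qed

lemma M_scaled:
  assumes x: "x \<in> M"
  obtains s y where "1 \<le> s" "y \<in> right_line" "x = s *\<^sub>R y"
proof -
  obtain i where i: "0 < A i" "A i \<le> B i" "0 \<le> D (U i) x" "D (U i + V i) x \<le> 0" using M_sector[OF x] .
  define s q where "s = D x (V i)" and "q = D (U i) x"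
  have s: "1 \<le> s" using x i by (simp add: M_def s_def)
  have q: "0 \<le> q" "q \<le> s" using i D_anti[of x "V i"] by (auto simp: s_def q_def)
  have exp: "x = s *\<^sub>R U i + q *\<^sub>R V i" unfolding s_def q_def by (rule D_expand[OF UV])
  \<comment> \<open>Dividing by \<open>s\<close> moves \<open>x\<close> to the line
    \<open>D y (V i) = 1\<close> that carries the edge.\<close>
  define y where "y = (1 - q / s) *\<^sub>R U i + (q / s) *\<^sub>R (U i + V i)"
  have "y \<in> closed_segment (U i) (U i + V i)"
    unfolding in_segment y_def using s q by (intro exI[of _ "q / s"]) auto
  then have "y \<in> right_line" using i by (auto simp: right_line_eq)
  moreover have "x = s *\<^sub>R y" using s by (simp add: exp y_def algebra_simps)
  ultimately show ?thesis using that s by blast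
qed

lemma K_eq_M: "K = M"
  using K_subset_M M_scaled K_scale right_line_subset_K by (metis subsetD subsetI subset_antisym)

text \<open>The hull of an infinite closed set may fail to be closed; here the half-planes
  decide.\<close>

lemma closed_K: "closed K"
proof -
  have "M = {x. 0 \<le> c2 x} \<inter> {x. 0 \<le> D x w} \<inter> (\<Inter>i \<in> {i. 0 < A i}. {x. 1 \<le> D x (V i)})"
    by (auto simp: M_def cone1_def)
  then show ?thesis
    unfolding K_eq_M by (auto intro!: closed_Int closed_INT closed_Collect_le continuous_intros)
qed

lemma K_plus_open_cone:
  assumes x: "x \<in> K" and z: "0 < c2 z" "0 < D z w"
  shows "x + z \<in> interior K"
proof -
  let ?O = "{y. 0 < c2 (y - x) \<and> 0 < D (y - x) w}"
  have "?O = {y. c2 x < c2 y \<and> D x w < D y w}"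
    by (simp add: D_def linear_diff[OF linear_c1] linear_diff[OF linear_c2] algebra_simps)
  moreover have "open {y. c2 x < c2 y \<and> D x w < D y w}"
    by (intro open_Collect_conj open_Collect_less continuous_intros)
  moreover have "y \<in> K" if y: "y \<in> ?O" for y
  proof -
    have cone: "y - x \<in> cone1" "y - x \<noteq> 0" using y by (auto simp: cone1_def)
    have "D y (V i) = D x (V i) + D (y - x) (V i)" for i
      by (simp add: D_def linear_diff[OF linear_c1] linear_diff[OF linear_c2] algebra_simps)
    then have "1 \<le> D y (V i)" if "0 < A i" for i
      using cone1_D_V[OF cone that] x that by (fastforce simp: K_eq_M M_def)
    moreover have "y = x + (y - x)" by simp
    then have "c2 y = c2 x + c2 (y - x)" "D y w = D x w + D (y - x) w" by (metis coords_simps(2), metis D_simps(1))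
    then have "y \<in> cone1" using x cone by (auto simp: K_eq_M M_def cone1_def)
    ultimately show ?thesis by (simp add: K_eq_M M_def)
  qed
  moreover have "x + z \<in> ?O" using z by simp
  ultimately show ?thesis by (intro interiorI[of ?O]) auto
qed

text \<open>Meeting \<open>l\<close> at parameter \<open>t\<close> of an edge means
  \<open>B i = t * A i\<close>; with \<open>A i \<le> B i\<close> and \<open>t \<le> 1\<close> this
  leaves only the far end at a tie.\<close>

lemma right_line_on_ray:
  assumes x: "x \<in> right_line" "D x w = 0"
  obtains i where "0 < A i" "A i = B i" "x = U i + V i"
proof -
  obtain i t where i: "0 < A i" "A i \<le> B i" and t: "0 \<le> t" "t \<le> 1" "x = (1 - t) *\<^sub>R U i + t *\<^sub>R (U i + V i)"
    using x(1) by (auto simp: right_line_eq in_segment)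
  have "B i = t * A i" using x(2) D_V_w[of i] unfolding t(3) by (simp add: B_def algebra_simps)
  then have "A i = B i" "t = 1"
    using i t by (smt (verit) mult_left_le_one_le mult_cancel_right2)+
  then show ?thesis using that i t by simp
qed

lemma right_line_cone1: "x \<in> right_line \<Longrightarrow> 0 \<le> c2 x \<and> 0 \<le> D x w \<and> 1 \<le> c1 x"
  using right_line_subset_K w_pos unfolding K_eq_M M_def cone1_def
  by (metis (mono_tags, lifting) D_simps(11) chain_0(2,3) mem_Collect_eq subsetD)

lemma interior_K_triangle: "0 < A i \<Longrightarrow> interior K \<inter> triangle (U i, V i) = {}"
proof -
  assume i: "0 < A i"
  have "1 < D x (V i)" if "x \<in> interior K" for x
    by (rule interior_halfspace_strict[OF linear_D(2) _ _ that, where z = "- U i"])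
      (use i in \<open>auto simp: K_eq_M M_def\<close>)
  then show ?thesis by (force simp: triangle_eq)
qed

text \<open>A point \<open>s *\<^sub>R y\<close> with \<open>s > 1\<close> and \<open>y\<close> off
  both sides of the cone is \<open>y\<close> plus a vector of the open cone, hence interior.
  Conversely each of the three pieces lies on a supporting line: \<open>c2 = 0\<close>, some
  \<open>D x (V i) = 1\<close>, or \<open>D x w = 0\<close>.\<close>

lemma frontier_K:
  "frontier K = {t *\<^sub>R e1 | t. 1 \<le> t} \<union> right_line \<union>
     {s *\<^sub>R x | s x. 1 < s \<and> x \<in> right_line \<and> D x w = 0}" (is "_ = ?d \<union> _ \<union> ?r")
proof
  have front: "frontier K = K - interior K" using closed_K by (simp add: frontier_def)
  show "frontier K \<subseteq> ?d \<union> right_line \<union> ?r"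
  proof
    fix x assume x: "x \<in> frontier K"
    then have "x \<in> M" using front K_eq_M by simp
    then obtain s y where y: "1 \<le> s" "y \<in> right_line" "x = s *\<^sub>R y" using M_scaled by blast
    have ge: "0 \<le> c2 y" "0 \<le> D y w" "1 \<le> c1 y" using right_line_cone1[OF y(2)] by auto
    consider "s = 1" | "1 < s" "c2 y = 0" | "1 < s" "D y w = 0" | "1 < s" "0 < c2 y" "0 < D y w"
      using y(1) ge by force
    then show "x \<in> ?d \<union> right_line \<union> ?r"
    proof cases
      case 1
      then show ?thesis using y by simp
    next
      case 2
      then have "y = c1 y *\<^sub>R e1" by (intro coords_eqI) auto
      then have "x = (s * c1 y) *\<^sub>R e1" using y by (metis scaleR_scaleR)
      moreover have "1 \<le> s * c1 y" using y ge mult_mono[of 1 s 1 "c1 y"] by simp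
      ultimately show ?thesis by blast
    next
      case 3
      then show ?thesis using y by blast
    next
      case 4
      have "y \<in> K" using y right_line_subset_K by blast
      then have "y + (s - 1) *\<^sub>R y \<in> interior K" using 4 by (intro K_plus_open_cone) auto
      moreover have "y + (s - 1) *\<^sub>R y = x" by (simp add: y algebra_simps)
      ultimately show ?thesis using x front by simp
    qed
  qed
  have "x \<in> K - interior K" if x: "x \<in> ?d \<union> right_line \<union> ?r" for x
  proof -
    have K2: "K \<subseteq> {y. 0 \<le> c2 y}" and Kw: "K \<subseteq> {y. 0 \<le> D y w}" by (auto simp: K_eq_M M_def cone1_def)
    from x consider t where "1 \<le> t" "x = t *\<^sub>R e1" | "x \<in> right_line"
      | s y where "1 < s" "y \<in> right_line" "D y w = 0" "x = s *\<^sub>R y"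
      by blast
    then show ?thesis
    proof cases
      case 1
      have "x \<notin> interior K"
        using interior_halfspace_strict[OF linear_c2 K2, of "- e2" x] 1 by auto
      then show ?thesis using K_scale[OF U_in_K[of 0]] 1 by simp
    next
      case 2
      then obtain i t where i: "0 < A i" and t: "x = (1 - t) *\<^sub>R U i + t *\<^sub>R (U i + V i)"
        by (auto simp: right_line_eq in_segment)
      have "D x (V i) = 1" unfolding t by simp
      moreover have "K \<subseteq> {y. 1 \<le> D y (V i)}" using i by (auto simp: K_eq_M M_def)
      ultimately have "x \<notin> interior K"
        using interior_halfspace_strict[OF linear_D(2), of K 1 "V i" "- U i" x] by auto
      then show ?thesis using 2 right_line_subset_K by blast
    next
      case 3
      have "x \<notin> interior K"
        using interior_halfspace_strict[OF linear_D(2) Kw, of e2 x] 3 w_pos by auto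
      then show ?thesis using K_scale[of y s] 3 right_line_subset_K by auto
    qed
  qed
  then show "?d \<union> right_line \<union> ?r \<subseteq> frontier K" unfolding front by blast
qed

section \<open>The boundary of the sheath\<close>

lemma swapped: "ray_in_cone e2 e1 c2 c1 w"
  by unfold_locales (use w_pos in \<open>simp_all add: linear_c1 linear_c2\<close>, subst add.commute, rule expand)

definition sheath_set :: "'a set" where
  "sheath_set = (\<Union>p \<in> petals. triangle p)"

lemma sheath_eq: "sheath e1 e2 ray = sheath_set"
  by (simp add: sheath_def sheath_petals_eq sheath_set_def)

lemma triangle_swap: "triangle (u, v) = triangle (v, u)"
  by (simp add: triangle.simps insert_commute add.commute)

lemma sheath_set_eq: "sheath_set = (\<Union>i \<in> {i. 0 < A i}. triangle (U i, V i))"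
  by (simp add: sheath_set_def petals_eq chain_UV)

definition left_line :: "'a set" where
  "left_line = (\<Union>(u, v) \<in> {(u, v). (u, v) \<in> petals \<and> D u w \<le> D w v}. closed_segment v (u + v))"

lemma left_line_eq: "left_line = (\<Union>i \<in> {i. 0 < A i \<and> B i \<le> A i}. closed_segment (V i) (U i + V i))"
proof -
  have "{(u, v). (u, v) \<in> petals \<and> D u w \<le> D w v} = chain ` {i. 0 < A i \<and> B i \<le> A i}"
    by (auto simp: petals_eq chain_UV A_def B_def)
  then show ?thesis by (simp only: left_line_def) (simp add: chain_UV)
qed

lemma triangle_coords:
  assumes "x \<in> triangle (U i, V i)"
  shows "0 \<le> D x (V i)" "D x (V i) \<le> 1" "0 \<le> D (U i) x" "D (U i) x \<le> 1" "1 \<le> D x (V i) + D (U i) x"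
    "x = D x (V i) *\<^sub>R U i + D (U i) x *\<^sub>R V i"
proof -
  show "x = D x (V i) *\<^sub>R U i + D (U i) x *\<^sub>R V i" by (rule D_expand[OF UV])
qed (use assms in \<open>auto simp: triangle_eq\<close>)

lemma triangle_height:
  assumes x: "x \<in> triangle (U i, V i)" and r: "0 \<le> r" "r \<le> height (U i)" "r \<le> height (V i)"
  shows "r \<le> height x"
proof -
  note c = triangle_coords[OF x]
  have "height x = D x (V i) * height (U i) + D (U i) x * height (V i)"
    using arg_cong[OF c(6), of height] by simp
  moreover have "D x (V i) * r \<le> D x (V i) * height (U i)" "D (U i) x * r \<le> D (U i) x * height (V i)"
    using c r by (auto intro: mult_left_mono)
  moreover have "1 * r \<le> (D x (V i) + D (U i) x) * r" using c r by (intro mult_right_mono)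
  ultimately show ?thesis by (simp add: distrib_right)
qed

lemma sheath_set_height: "x \<in> sheath_set \<Longrightarrow> 1 \<le> height x"
  using triangle_height[where r = 1] height_UV by (auto simp: sheath_set_eq)

lemma linear_height: "linear height"
  by (simp add: linear_iff)

text \<open>An infinite sheath is locally finite: only finitely many petals reach below a given
  height.\<close>

lemma closed_sheath_set: "closed sheath_set"
proof (cases "\<forall>i. 0 < A i")
  case True
  have "closure sheath_set \<subseteq> sheath_set"
  proof
    fix x assume x: "x \<in> closure sheath_set"
    \<comment> \<open>The absolute value keeps \<open>r\<close> nonnegative, as
      \<open>triangle_height\<close> requires.\<close>
    define r where "r = \<bar>height x\<bar> + 1"
    obtain i where i: "\<And>j. i \<le> j \<Longrightarrow> r \<le> height (U j) \<and> r \<le> height (V j)"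
      using height_unbounded True by blast
    define F where "F = (\<Union>j\<in>{..<i}. triangle (U j, V j))"
    have F: "closed F" "F \<subseteq> sheath_set"
      using True by (auto simp: F_def sheath_set_eq intro!: closed_UN compact_imp_closed compact_triangle)
    have "{y. height y < r} \<inter> sheath_set \<subseteq> F"
    proof safe
      fix y assume y: "height y < r" "y \<in> sheath_set"
      then obtain j where j: "y \<in> triangle (U j, V j)" by (auto simp: sheath_set_eq)
      have "j < i" using triangle_height[OF j, of r] i[of j] y by (force simp: r_def)
      then show "y \<in> F" using j by (auto simp: F_def)
    qed
    moreover have "open {y. height y < r}"
      unfolding height_def by (intro open_Collect_less continuous_intros)
    moreover have "x \<in> {y. height y < r}" by (simp add: r_def)
    ultimately have "x \<in> closure F"
      using x open_Int_closure_subset closure_mono by blast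
    then show "x \<in> sheath_set" using F by auto
  qed
  then show ?thesis by (simp add: closure_subset_eq)
next
  case False
  then obtain n where "0 < A n" "A n = B n" using tie_or_live by blast
  then have "{i. 0 < A i} = {..n}" using tie_unique by auto
  then show ?thesis
    unfolding sheath_set_eq by (auto intro!: closed_UN compact_imp_closed compact_triangle)
qed

lemma right_line_not_interior: "right_line \<inter> interior sheath_set = {}"
proof -
  have False if x: "x \<in> right_line" "x \<in> interior sheath_set" for x
  proof -
    \<comment> \<open>\<open>e1 + w\<close> points strictly into \<open>cone1\<close>, so a push
      along it enters the interior of \<open>K\<close>.\<close>
    obtain \<epsilon> where e: "0 < \<epsilon>" "x + \<epsilon> *\<^sub>R (e1 + w) \<in> sheath_set"
      using interior_move[OF x(2), of "e1 + w"] by blast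
    have "x + \<epsilon> *\<^sub>R (e1 + w) \<in> interior K"
      using x right_line_subset_K e(1) w_pos by (intro K_plus_open_cone) auto
    then show False using e(2) interior_K_triangle by (auto simp: sheath_set_eq)
  qed
  then show ?thesis by blast
qed

lemma U_in_right_line: "0 < A i \<Longrightarrow> U i \<in> right_line"
  using ex_left_turn[of i] unfolding right_line_eq
  by (metis (mono_tags, lifting) UN_I ends_in_segment(1) mem_Collect_eq)

lemma V_in_left_line: "0 < A i \<Longrightarrow> V i \<in> left_line"
  using ex_right_turn[of i] unfolding left_line_eq
  by (metis (mono_tags, lifting) UN_I ends_in_segment(1) mem_Collect_eq)

lemma right_line_subset_sheath: "right_line \<subseteq> sheath_set"
proof
  fix x assume "x \<in> right_line"
  then obtain i t where i: "0 < A i" and t: "0 \<le> t" "t \<le> 1" "x = (1 - t) *\<^sub>R U i + t *\<^sub>R (U i + V i)"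
    by (auto simp: right_line_eq in_segment)
  have "x \<in> triangle (U i, V i)" using t by (simp add: triangle_eq)
  then show "x \<in> sheath_set" using i by (auto simp: sheath_set_eq)
qed

text \<open>The two petals fill the triangle with vertices \<open>u\<close>, \<open>v\<close>,
  \<open>2 u + v\<close>, and the common side is the median from \<open>u\<close> to the midpoint
  \<open>u + v\<close>. The set \<open>?O\<close> below is the open triangle.\<close>

lemma inner_base_right:
  assumes uv: "D u v = 1" and t: "0 < t" "t < 1"
  shows "u + t *\<^sub>R v \<in> interior (triangle (u, v) \<union> triangle (u, u + v))"
proof -
  let ?O = "{x. 0 < D u x \<and> D u x < 1 \<and> 1 < D x v + D u x \<and> D x (u + v) < 1}"
  have xu: "D x u = - D u x" for x by (rule D_anti)
  have "open ?O" by (intro open_Collect_conj open_Collect_less continuous_intros)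
  moreover have "D u (u + v) = 1" using uv by simp
  then have "?O \<subseteq> triangle (u, v) \<union> triangle (u, u + v)"
    using uv by (auto simp: triangle_eq xu)
  moreover have "u + t *\<^sub>R v \<in> ?O" using uv t by (simp add: xu)
  ultimately show ?thesis using interior_maximal by blast
qed

lemma right_line_base: "right_line \<inter> closed_segment e1 e2 \<subseteq> {e1}"
proof
  fix x assume x: "x \<in> right_line \<inter> closed_segment e1 e2"
  then obtain t where t: "0 \<le> t" "x = (1 - t) *\<^sub>R e1 + t *\<^sub>R e2" by (auto simp: in_segment)
  then show "x \<in> {e1}" using right_line_cone1[of x] x by simp
qed

text \<open>Seen from 0, later vertices never fall back behind \<open>U k\<close>. This keeps the
  polygonal line from crossing itself.\<close>

lemma D_U_mono: "k \<le> j \<Longrightarrow> 0 \<le> D (U k) (U j) \<and> 0 \<le> D (U k) (V j)"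
proof (induction j rule: dec_induct)
  case (step j)
  then show ?case by (cases "B j \<le> A j") (auto simp: step_right step_left not_le)
qed simp

lemma joining_tail:
  assumes n: "0 < A n" "A n = B n" and i: "i \<le> n"
  shows "joining_polygonal_line (U i) (U n + V n)
           (\<Union>j\<in>{j. i \<le> j \<and> j \<le> n \<and> A j \<le> B j}. closed_segment (U j) (U j + V j))"
  using i
proof (induction i rule: inc_induct)
  case base
  have "{j. n \<le> j \<and> j \<le> n \<and> A j \<le> B j} = {n}" using n by auto
  moreover have "V n \<noteq> 0" using UV_coords[of n] by auto
  ultimately show ?case by (simp add: joining_polygonal_line_segment)
next
  case (step i)
  let ?T = "\<lambda>i. \<Union>j\<in>{j. i \<le> j \<and> j \<le> n \<and> A j \<le> B j}. closed_segment (U j) (U j + V j)"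
  have "A i \<noteq> B i"
    using tie_unique[OF n, of "Suc i"] step.hyps step_right(3)[of i] by auto
  show ?case
  proof (cases "B i \<le> A i")
    case True
    have "{j. i \<le> j \<and> j \<le> n \<and> A j \<le> B j} = {j. Suc i \<le> j \<and> j \<le> n \<and> A j \<le> B j}"
      using True \<open>A i \<noteq> B i\<close> by (auto simp: Suc_le_eq le_less)
    then show ?thesis using step.IH True by (simp add: step_right)
  next
    case False
    then have Suc: "U (Suc i) = U i + V i" by (simp add: step_left)
    have "{j. i \<le> j \<and> j \<le> n \<and> A j \<le> B j} = insert i {j. Suc i \<le> j \<and> j \<le> n \<and> A j \<le> B j}"
      using False step.hyps by auto
    then have T: "?T i = closed_segment (U i) (U i + V i) \<union> ?T (Suc i)" by auto
    \<comment> \<open>The line through 0 and \<open>U (Suc i)\<close> separates: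
      \<open>D (U (Suc i))\<close> is nonnegative on all later edges, and on the new edge it is
      negative except at the far end, where it vanishes.\<close>
    have "closed_segment (U i) (U i + V i) \<inter> ?T (Suc i) \<subseteq> {U i + V i}"
    proof safe
      fix x j assume x: "x \<in> closed_segment (U i) (U i + V i)" and j: "Suc i \<le> j"
        and xj: "x \<in> closed_segment (U j) (U j + V j)"
      obtain t where t: "t \<le> 1" "x = (1 - t) *\<^sub>R U i + t *\<^sub>R (U i + V i)" using x by (auto simp: in_segment)
      obtain s where s: "0 \<le> s" "x = (1 - s) *\<^sub>R U j + s *\<^sub>R (U j + V j)" using xj by (auto simp: in_segment)
      have "D (U (Suc i)) x = D (U (Suc i)) (U j) + s * D (U (Suc i)) (V j)"
        unfolding s(2) by (simp add: algebra_simps)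
      then have "0 \<le> D (U (Suc i)) x" using D_U_mono[OF j] s(1) by simp
      moreover have "D (U (Suc i)) x = t - 1" unfolding t(2) Suc by (simp add: algebra_simps)
      ultimately have "t = 1" using t(1) by simp
      then show "x = U i + V i" using t(2) by simp
    qed
    moreover have "U i \<noteq> U i + V i" using UV_coords[of i] by auto
    ultimately show ?thesis
      unfolding T using step.IH by (intro joining_polygonal_line_Cons) (simp_all add: Suc)
  qed
qed

lemma joining_right_line:
  assumes uv: "(u, v) \<in> petals" "D w v = D u w"
  shows "joining_polygonal_line e1 (u + v) right_line"
proof -
  obtain n where n: "0 < A n" "u = U n" "v = V n" using uv by (auto simp: petals_eq chain_UV)
  then have tie: "A n = B n" using uv by (simp add: A_def B_def)
  have "{i. 0 < A i \<and> A i \<le> B i} = {j. 0 \<le> j \<and> j \<le> n \<and> A j \<le> B j}"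
    using tie_unique[OF n(1) tie] by auto
  then show ?thesis using joining_tail[OF n(1) tie, of 0] by (simp add: right_line_eq n)
qed

section \<open>Ties and the primitive lattice point of a rational half-line\<close>

lemma tie_w: "0 < A n \<Longrightarrow> A n = B n \<Longrightarrow> w = A n *\<^sub>R (U n + V n)"
  using D_expand[OF UV[of n], of w] by (simp add: A_def B_def scaleR_add_right)

lemma tie_on_ray:
  assumes "0 < A n" "A n = B n"
  shows "U n + V n = (1 / A n) *\<^sub>R w"
proof -
  have "(1 / A n) *\<^sub>R w = (1 / A n) *\<^sub>R (A n *\<^sub>R (U n + V n))"
    by (rule arg_cong[OF tie_w[OF assms]])
  then show ?thesis using assms(1) by simp
qed

lemma tie_index_unique: "0 < A n \<Longrightarrow> A n = B n \<Longrightarrow> 0 < A m \<Longrightarrow> A m = B m \<Longrightarrow> m = n"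
  using tie_unique[of n m] tie_unique[of m n] by simp

text \<open>If \<open>t *\<^sub>R w\<close> is a lattice point and the algorithm is endless, then
  \<open>t * A i\<close> is a positive integer for every \<open>i\<close>. Hence
  \<open>t * height w\<close> is at least \<open>height (U i)\<close>, which is unbounded.\<close>

lemma rational_iff: "rational lattice ray \<longleftrightarrow> (\<exists>n. 0 < A n \<and> A n = B n)"
proof
  assume "rational lattice ray"
  then obtain t where t: "t *\<^sub>R w \<in> lattice" "0 < t"
    unfolding rational_def ray_def by (auto simp: less_le)
  show "\<exists>n. 0 < A n \<and> A n = B n"
  proof (rule ccontr)
    assume "\<not> ?thesis"
    then have live: "0 < A i" for i using tie_or_live by blast
    obtain i where i: "t * height w + 1 \<le> height (U i)" using height_unbounded[OF live] by blast
    have "t * A i \<in> \<int>" using D_lattice[OF t(1), of "V i"] UV_coords[of i] by (simp add: A_def)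
    then have "1 \<le> t * A i" using t(2) live by (intro Ints_pos_ge_1) auto
    then have "1 * height (U i) \<le> t * A i * height (U i)" using height_UV[of i] by (intro mult_right_mono) auto
    moreover have "height w = A i * height (U i) + B i * height (V i)"
      using arg_cong[OF D_expand[OF UV[of i], of w], of height] by (simp add: A_def B_def)
    then have "t * height w = t * A i * height (U i) + t * (B i * height (V i))"
      by (simp add: algebra_simps)
    moreover have "0 \<le> t * (B i * height (V i))" using t(2) B_pos[of i] height_UV[of i] by simp
    ultimately show False using i by linarith
  qed
next
  assume "\<exists>n. 0 < A n \<and> A n = B n"
  then obtain n where n: "0 < A n" "A n = B n" by blast
  have "U n + V n \<in> lattice" using UV_coords[of n] by (auto simp: lattice_def)
  moreover have "U n + V n = (1 / A n) *\<^sub>R w" by (rule tie_on_ray[OF n])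
  then have "U n + V n \<in> ray" using n unfolding ray_def by (auto intro!: exI[of _ "1 / A n"])
  moreover have "c1 (U n + V n) \<noteq> 0" using UV_coords[of n] by simp
  then have "U n + V n \<noteq> 0" by (metis coords_simps(5))
  ultimately show "rational lattice ray" unfolding rational_def by blast
qed

text \<open>\<open>D (U n) (U n + V n) = 1\<close> is used twice: it makes this point primitive, and
  it shows that a lattice point of \<open>l\<close> is an integer multiple of it.\<close>

lemma prim_point_eq:
  assumes n: "0 < A n" "A n = B n"
  shows "prim_point lattice ray = U n + V n"
  unfolding prim_point_def
proof (rule the_equality)
  let ?S = "U n + V n"
  have S_ray: "?S = (1 / A n) *\<^sub>R w" by (rule tie_on_ray[OF n])
  have S_lat: "?S \<in> lattice" using UV_coords[of n] by (auto simp: lattice_def)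
  have "c1 ?S \<noteq> 0" using UV_coords[of n] by simp
  then have S0: "?S \<noteq> 0" by (metis coords_simps(5))
  have "\<bar>k\<bar> = 1" if y: "y \<in> lattice" "?S = of_int k *\<^sub>R y" for y k
  proof -
    have "D (U n) ?S = of_int k * D (U n) y" by (simp only: y(2) D_simps)
    then have "1 = of_int k * D (U n) y" by simp
    moreover obtain m where "D (U n) y = of_int m"
      using D_lattice[of "U n" y] y UV_coords[of n] by (auto elim: Ints_cases)
    ultimately have "1 = k * m" by (metis of_int_eq_1_iff of_int_mult)
    then show ?thesis by (metis dvd_triv_left zdvd1_eq)
  qed
  then show "?S \<in> ray \<and> primitive lattice ?S"
    using S_ray S_lat S0 n by (auto simp: primitive_def ray_def intro!: exI[of _ "1 / A n"])
  fix x assume x: "x \<in> ray \<and> primitive lattice x"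
  then obtain s where s: "0 \<le> s" "x = s *\<^sub>R w" by (auto simp: ray_def)
  have xS: "x = (s * A n) *\<^sub>R ?S" using tie_w[OF n] s by (metis scaleR_scaleR)
  have "D (U n) x \<in> \<int>" using x D_lattice[of "U n" x] UV_coords[of n] by (auto simp: primitive_def)
  then obtain m where m: "s * A n = of_int m" by (auto simp: xS elim: Ints_cases)
  then have "\<bar>m\<bar> = 1" using x S_lat xS unfolding primitive_def by metis
  moreover have "0 \<le> s * A n" using s n by simp
  ultimately have "m = 1" using m by (simp add: abs_if split: if_splits)
  then show "x = ?S" using xS m by simp
qed

text \<open>For endless algorithms \<open>R n\<close> exhausts the line by connected pieces
  containing \<open>e1\<close>; the next edge is attached at \<open>U n\<close>.\<close>

lemma connected_right_line: "connected right_line"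
proof -
  define R where "R n = (\<Union>i\<in>{i. i < n \<and> A i \<le> B i}. closed_segment (U i) (U i + V i)) \<union> {e1}" for n
  have R: "connected (R n) \<and> U n \<in> R n" if "n = 0 \<or> (\<forall>i<n. 0 < A (Suc i))" for n
    using that
  proof (induction n)
    case 0
    then show ?case by (simp add: R_def)
  next
    case (Suc n)
    then have IH: "connected (R n)" "U n \<in> R n" by auto
    have "A n \<noteq> B n" using Suc.prems step_right(3)[of n] by auto
    show ?case
    proof (cases "A n \<le> B n")
      case True
      then have "{i. i < Suc n \<and> A i \<le> B i} = insert n {i. i < n \<and> A i \<le> B i}" by auto
      then have "R (Suc n) = closed_segment (U n) (U n + V n) \<union> R n" by (auto simp: R_def)
      moreover have "connected (closed_segment (U n) (U n + V n) \<union> R n)"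
        using IH by (intro connected_Un) auto
      ultimately show ?thesis using True \<open>A n \<noteq> B n\<close> by (simp add: step_left)
    next
      case False
      then have "{i. i < Suc n \<and> A i \<le> B i} = {i. i < n \<and> A i \<le> B i}" by (auto simp: less_Suc_eq)
      then have "R (Suc n) = R n" by (simp add: R_def)
      then show ?thesis using IH False by (simp add: step_right)
    qed
  qed
  show ?thesis
    using tie_or_live
  proof
    assume live: "\<forall>i. 0 < A i"
    have "e1 \<in> right_line" using U_in_right_line[of 0] w_pos by simp
    then have "right_line = (\<Union>n. R n)"
      using live by (auto simp: right_line_eq R_def)
    moreover have "connected (\<Union>n. R n)"
      using R live by (intro connected_Union) (auto simp: R_def)
    ultimately show ?thesis by simp
  next
    assume "\<exists>n. 0 < A n \<and> A n = B n"
    then obtain n where n: "0 < A n" "A n = B n" by blast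
    have "(U n, V n) \<in> petals" "D w (V n) = D (U n) w"
      using n by (auto simp: petals_eq chain_UV A_def B_def)
    then show ?thesis
      using joining_right_line joining_polygonal_line_arc connected_arc_image by metis
  qed
qed

lemma convex_cone_hull_side: "convex_cone hull (insert e1 ray) = cone1"
proof (rule hull_unique)
  have "t * c2 w \<ge> 0" if "0 \<le> t" for t using that w_pos by simp
  then show "insert e1 ray \<subseteq> cone1" using w_pos by (auto simp: cone1_def ray_def)
  show "convex_cone cone1" by (auto simp: convex_cone_iff cone1_def)
  fix T assume T: "insert e1 ray \<subseteq> T" "convex_cone T"
  show "cone1 \<subseteq> T"
  proof
    fix x assume x: "x \<in> cone1"
    \<comment> \<open>Cramer's rule in the basis \<open>(e1, w)\<close>, whose determinant is
      \<open>c2 w\<close>.\<close>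
    have "x = (D x w / c2 w) *\<^sub>R e1 + (c2 x / c2 w) *\<^sub>R w"
      using w_pos by (intro coords_eqI) (simp_all add: D_def field_simps)
    moreover have "w \<in> ray" unfolding ray_def by (auto intro!: exI[of _ 1])
    then have "w \<in> T" "e1 \<in> T" using T by auto
    moreover have "0 \<le> D x w / c2 w" "0 \<le> c2 x / c2 w" using x w_pos by (auto simp: cone1_def)
    ultimately show "x \<in> T" using T(2) by (metis convex_cone_add convex_cone_scaleR)
  qed
qed

end

context ray_in_cone
begin

text \<open>
  Exchanging \<open>e1\<close> and \<open>e2\<close> exchanges right and left. The interpretation only carries over facts that
  precede it, so it is made again below.
\<close>

interpretation swap: ray_in_cone e2 e1 c2 c1 w
  by (rule swapped)

lemma swap_D: "swap.D x y = D y x"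
  by (simp add: D_def swap.D_def)

lemma swap_petals: "(u, v) \<in> swap.petals \<longleftrightarrow> (v, u) \<in> petals"
  using lotus_swap[of u v e2 e1] lotus_swap[of v u e1 e2]
  by (auto simp: petals_def swap.petals_def swap_D)

lemma swap_lattice: "swap.lattice = lattice"
  by (auto simp: lattice_def swap.lattice_def)

lemma swap_sheath: "swap.sheath_set = sheath_set"
proof -
  have "swap.petals = prod.swap ` petals"
  proof (rule set_eqI)
    fix p show "p \<in> swap.petals \<longleftrightarrow> p \<in> prod.swap ` petals"
      by (cases p) (force simp: swap_petals)
  qed
  moreover have "triangle (prod.swap p) = triangle p" for p :: "'a \<times> 'a"
    by (cases p) (simp add: triangle_swap)
  ultimately show ?thesis by (simp add: sheath_set_def swap.sheath_set_def)
qed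

lemma swap_right_line: "swap.right_line = left_line"
proof -
  have "{(u, v). (u, v) \<in> swap.petals \<and> swap.D w v \<le> swap.D u w}
      = prod.swap ` {(u, v). (u, v) \<in> petals \<and> D u w \<le> D w v}"
    by (force simp: swap_petals swap_D)
  then show ?thesis
    unfolding swap.right_line_def left_line_def by (simp add: case_prod_unfold add.commute)
qed

lemma left_line_not_interior: "left_line \<inter> interior sheath_set = {}"
  using swap.right_line_not_interior by (simp add: swap_right_line swap_sheath)

lemma left_line_subset_sheath: "left_line \<subseteq> sheath_set"
  using swap.right_line_subset_sheath by (simp add: swap_right_line swap_sheath)

lemma inner_base_left:
  assumes uv: "D u v = 1" and t: "0 < t" "t < 1"
  shows "v + t *\<^sub>R u \<in> interior (triangle (u, v) \<union> triangle (u + v, v))"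
  using swap.inner_base_right[of v u t] uv t
  by (simp add: swap_D triangle_swap[of v] add.commute[of u])

text \<open>After the first petal, a base is the side shared with the preceding petal: its inner
  points are interior to the union of the two, and its ends are vertices on the boundary
  lines.\<close>

lemma base_cover:
  assumes i: "0 < A i" and x: "x = p *\<^sub>R U i + q *\<^sub>R V i" "0 \<le> p" "0 \<le> q" "p + q = 1"
  shows "x \<in> closed_segment e1 e2 \<union> right_line \<union> left_line \<union> interior sheath_set"
proof (cases i)
  case 0
  then have "x \<in> closed_segment e1 e2" using x by (auto simp: in_segment intro!: exI[of _ q])
  then show ?thesis by blast
next
  case (Suc k)
  have live: "0 < A k" using live_down[OF i] Suc by simp
  have q: "q = 1 - p" using x by simp
  consider "p = 0" | "p = 1" | "0 < p" "p < 1" using x by force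
  then show ?thesis
  proof cases
    case 1
    then show ?thesis using V_in_left_line[OF i] x q by simp
  next
    case 2
    then show ?thesis using U_in_right_line[OF i] x q by simp
  next
    case 3
    have "x \<in> interior (triangle (U k, V k) \<union> triangle (U i, V i))"
    proof (cases "B k \<le> A k")
      case True
      then have UVi: "U i = U k" "V i = U k + V k" by (simp_all add: Suc step_right)
      have "x = U k + (1 - p) *\<^sub>R V k" unfolding x(1) UVi q by (simp add: algebra_simps)
      then show ?thesis using inner_base_right[OF UV[of k], of "1 - p"] 3 by (simp add: UVi)
    next
      case False
      then have UVi: "U i = U k + V k" "V i = V k" by (simp_all add: Suc step_left)
      have "x = V k + p *\<^sub>R U k" unfolding x(1) UVi q by (simp add: algebra_simps)
      then show ?thesis using inner_base_left[OF UV[of k], of p] 3 by (simp add: UVi)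
    qed
    moreover have "triangle (U k, V k) \<union> triangle (U i, V i) \<subseteq> sheath_set"
      using i live by (auto simp: sheath_set_eq)
    ultimately show ?thesis using interior_mono by blast
  qed
qed

text \<open>A frontier point lies on a side of some petal. The base is treated by
  \<open>base_cover\<close>, and so is the side through which \<open>l\<close> leaves, being the
  base of the next petal; a remaining side belongs to \<open>right_line\<close> or
  \<open>left_line\<close>.\<close>

lemma frontier_sheath_set: "frontier sheath_set = closed_segment e1 e2 \<union> right_line \<union> left_line"
proof
  have front: "frontier sheath_set = sheath_set - interior sheath_set"
    using closed_sheath_set by (simp add: frontier_def)
  show "frontier sheath_set \<subseteq> closed_segment e1 e2 \<union> right_line \<union> left_line"
  proof
    fix x assume x: "x \<in> frontier sheath_set"
    then obtain i where i: "0 < A i" and xi: "x \<in> triangle (U i, V i)" using front by (auto simp: sheath_set_eq)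
    have "triangle (U i, V i) \<subseteq> sheath_set" using i by (auto simp: sheath_set_eq)
    then have "x \<notin> interior (triangle (U i, V i))" using x front interior_mono by blast
    then have notint: "\<not> (D x (V i) < 1 \<and> D (U i) x < 1 \<and> 1 < D x (V i) + D (U i) x)"
      by (simp add: interior_triangle)
    define p q where "p = D x (V i)" and "q = D (U i) x"
    note c = triangle_coords[OF xi, folded p_def q_def]
    have cov: "y \<in> closed_segment e1 e2 \<union> right_line \<union> left_line"
      if "0 < A j" "x = y" "y = p' *\<^sub>R U j + q' *\<^sub>R V j" "0 \<le> p'" "0 \<le> q'" "p' + q' = 1" for j y p' q'
      using base_cover[OF that(1,3-6)] x front that(2) by blast
    consider "p + q = 1" | "p = 1" "A i \<le> B i" | "p = 1" "B i < A i" | "q = 1" "B i \<le> A i" | "q = 1" "A i < B i"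
      using notint c by (fold p_def q_def) linarith
    then show "x \<in> closed_segment e1 e2 \<union> right_line \<union> left_line"
    proof cases
      case 1
      then show ?thesis using cov[OF i refl c(6)] c by blast
    next
      case 2
      have "x \<in> closed_segment (U i) (U i + V i)"
        unfolding in_segment using 2 c by (intro exI[of _ q]) (simp add: algebra_simps)
      then show ?thesis using 2 i by (auto simp: right_line_eq)
    next
      case 3
      have "x = (1 - q) *\<^sub>R U (Suc i) + q *\<^sub>R V (Suc i)"
        using 3 c(6) by (simp add: step_right algebra_simps)
      then show ?thesis using cov[of "Suc i" x "1 - q" q] 3 c by (simp add: step_right)
    next
      case 4
      have "x \<in> closed_segment (V i) (U i + V i)"
        unfolding in_segment using 4 c by (intro exI[of _ p]) (simp add: algebra_simps)
      then show ?thesis using 4 i by (auto simp: left_line_eq)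
    next
      case 5
      have "x = p *\<^sub>R U (Suc i) + (1 - p) *\<^sub>R V (Suc i)"
        using 5 c(6) by (simp add: step_left algebra_simps)
      then show ?thesis using cov[of "Suc i" x p "1 - p"] 5 c i by (simp add: step_left)
    qed
  qed
  have "x \<in> sheath_set - interior sheath_set" if x: "x \<in> closed_segment e1 e2" for x
  proof -
    obtain t where t: "0 \<le> t" "t \<le> 1" "x = (1 - t) *\<^sub>R e1 + t *\<^sub>R e2" using x by (auto simp: in_segment)
    have "x \<in> triangle (U 0, V 0)" using t by (subst triangle_eq) simp_all
    then have "x \<in> sheath_set" using w_pos by (auto simp: sheath_set_eq intro!: exI[of _ 0])
    \<comment> \<open>\<open>height\<close> is at least 1 on the sheath and equals 1 on the segment,
      so the segment lies on a supporting line.\<close>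
    moreover have "x \<notin> interior sheath_set"
      using interior_halfspace_strict[OF linear_height, of sheath_set 1 "- e1" x] sheath_set_height t
      by (auto simp: height_def)
    ultimately show ?thesis by blast
  qed
  then show "closed_segment e1 e2 \<union> right_line \<union> left_line \<subseteq> frontier sheath_set"
    using right_line_not_interior left_line_not_interior right_line_subset_sheath left_line_subset_sheath
    unfolding front by blast
qed

lemma left_line_base: "left_line \<inter> closed_segment e1 e2 \<subseteq> {e2}"
  using swap.right_line_base by (simp add: swap_right_line closed_segment_commute)

lemma left_line_side: "x \<in> left_line \<Longrightarrow> D x w \<le> 0"
  using swap.right_line_cone1[of x] D_anti[of x w] by (simp add: swap_right_line swap_D)

lemma joining_left_line:
  assumes "(u, v) \<in> petals" "D w v = D u w"
  shows "joining_polygonal_line e2 (u + v) left_line"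
  using swap.joining_right_line[of v u] assms
  by (simp add: swap_petals swap_D swap_right_line add.commute)

lemma right_line_Int_left_line:
  assumes "x \<in> right_line" "x \<in> left_line"
  obtains n where "0 < A n" "A n = B n" "x = U n + V n"
proof -
  have "D x w = 0" using right_line_cone1[of x] left_line_side[of x] assms by simp
  then show ?thesis using right_line_on_ray[OF assms(1)] that by blast
qed

text \<open>With a tie, \<open>right_line\<close>, \<open>left_line\<close> and the first base form
  a closed curve, and an arc missing a point of that base is determined by
  \<open>arc_in_closed_curve_unique\<close>. Without a tie the two lines lie strictly on opposite
  sides of \<open>l\<close>, where \<open>D x w\<close> has opposite signs.\<close>

lemma P_line_eq: "P_line lattice e1 e2 ray e1 = right_line"
proof (cases "rational lattice ray")
  case True
  then obtain n where n: "0 < A n" "A n = B n" using rational_iff by blast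
  let ?S = "U n + V n"
  have tie: "(U n, V n) \<in> petals" "D w (V n) = D (U n) w"
    using n by (auto simp: petals_eq chain_UV A_def B_def)
  obtain g where g: "arc g" "pathstart g = e1" "pathfinish g = ?S" "path_image g = right_line"
    using joining_polygonal_line_arc[OF joining_right_line[OF tie]] .
  obtain g' where g': "arc g'" "pathstart g' = e2" "pathfinish g' = ?S" "path_image g' = left_line"
    using joining_polygonal_line_arc[OF joining_left_line[OF tie]] .
  have L: "closed left_line" "?S \<in> left_line"
    using g' closed_arc_image pathfinish_in_path_image by metis+
  have RL: "right_line \<inter> left_line \<subseteq> {?S}"
    using right_line_Int_left_line tie_index_unique[OF n] by blast
  have front: "frontier (sheath e1 e2 ray) = right_line \<union> left_line \<union> closed_segment e1 e2"
    by (simp add: sheath_eq frontier_sheath_set Un_ac)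
  have "e1 \<noteq> e2" using c1_e1 c1_e2 by (metis zero_neq_one)
  then obtain m where m: "m \<in> open_segment e1 e2" by (metis all_not_in_conv open_segment_eq_empty)
  have nos: "\<not> open_segment e1 e2 \<subseteq> right_line"
    using right_line_base m by (auto simp: open_segment_def)
  have "(THE A. joining_polygonal_line e1 ?S A \<and> A \<subseteq> frontier (sheath e1 e2 ray) \<and> \<not> open_segment e1 e2 \<subseteq> A)
      = right_line"
  proof (rule the_equality)
    show "joining_polygonal_line e1 ?S right_line \<and> right_line \<subseteq> frontier (sheath e1 e2 ray)
        \<and> \<not> open_segment e1 e2 \<subseteq> right_line"
      using joining_right_line[OF tie] nos front by blast
    fix A assume A: "joining_polygonal_line e1 ?S A \<and> A \<subseteq> frontier (sheath e1 e2 ray) \<and> \<not> open_segment e1 e2 \<subseteq> A"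
    then obtain h where h: "arc h" "pathstart h = e1" "pathfinish h = ?S" "path_image h = A"
      using joining_polygonal_line_arc by blast
    obtain x where x: "x \<in> open_segment e1 e2" "x \<notin> path_image h" using A h by blast
    have "path_image h = right_line"
      by (rule arc_in_closed_curve_unique[OF g L RL right_line_base left_line_base h(1,2,3) _ x])
        (use A h front in simp)
    then show "A = right_line" using h by simp
  qed
  then show ?thesis using True by (simp add: P_line_def prim_point_eq[OF n])
next
  case False
  then have no_tie: "\<not> (\<exists>n. 0 < A n \<and> A n = B n)" using rational_iff by blast
  have right: "0 < D x w" if x: "x \<in> right_line" for x
  proof -
    have "D x w \<noteq> 0"
    proof
      assume "D x w = 0"
      with x show False by (rule right_line_on_ray) (use no_tie in blast)
    qed
    then show ?thesis using right_line_cone1[OF x] by simp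
  qed
  have "\<not> rational swap.lattice ray" using False by (simp only: swap_lattice not_False_eq_True)
  then have no_tie': "\<not> (\<exists>n. 0 < swap.A n \<and> swap.A n = swap.B n)" using swap.rational_iff by blast
  have left: "D x w < 0" if x: "x \<in> left_line" for x
  proof -
    have x': "x \<in> swap.right_line" using x by (simp only: swap_right_line)
    have "D x w \<noteq> 0"
    proof
      assume "D x w = 0"
      then have "swap.D x w = 0" using D_anti[of x w] by (simp add: swap_D)
      with x' show False by (rule swap.right_line_on_ray) (use no_tie' in blast)
    qed
    then show ?thesis using left_line_side[OF x] by simp
  qed
  have "frontier (sheath e1 e2 ray) - open_segment e1 e2 = right_line \<union> left_line"
  proof -
    have "e1 \<in> right_line" "e2 \<in> left_line"
      using U_in_right_line[of 0] V_in_left_line[of 0] w_pos by simp_all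
    moreover have "right_line \<inter> open_segment e1 e2 = {}" "left_line \<inter> open_segment e1 e2 = {}"
      using right_line_base left_line_base by (auto simp: open_segment_def)
    ultimately show ?thesis
      unfolding sheath_eq frontier_sheath_set by (auto simp: open_segment_def)
  qed
  moreover have "connected_component_set (right_line \<union> left_line) e1 = right_line"
  proof
    have e1: "e1 \<in> right_line" using U_in_right_line[of 0] w_pos by simp
    show "right_line \<subseteq> connected_component_set (right_line \<union> left_line) e1"
      using e1 connected_right_line by (intro connected_component_maximal) auto
    show "connected_component_set (right_line \<union> left_line) e1 \<subseteq> right_line"
    proof
      fix y assume "y \<in> connected_component_set (right_line \<union> left_line) e1"
      then obtain C where C: "connected C" "C \<subseteq> right_line \<union> left_line" "e1 \<in> C" "y \<in> C"
        by (auto simp: connected_component_def)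
      have op: "open {x. 0 < D x w}" "open {x. D x w < 0}"
        by (intro open_Collect_less continuous_intros)+
      have "C \<subseteq> {x. 0 < D x w} \<union> {x. D x w < 0}" using C(2) right left by blast
      moreover have "{x. 0 < D x w} \<inter> {x. D x w < 0} \<inter> C = {}" by auto
      ultimately have "{x. 0 < D x w} \<inter> C = {} \<or> {x. D x w < 0} \<inter> C = {}"
        using connectedD[OF C(1) op] by blast
      then show "y \<in> right_line" using C right[OF e1] left by blast
    qed
  qed
  ultimately show ?thesis using False by (simp add: P_line_def)
qed

theorem Q_line_right:
  "Q_line lattice e1 e2 ray e1 =
     frontier (convex hull {x \<in> lattice. x \<noteq> 0 \<and> x \<in> convex_cone hull (insert e1 ray)})"
proof -
  have "{s *\<^sub>R x | s x. 1 < s \<and> x \<in> right_line \<and> D x w = 0} =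
    (if rational lattice ray then ray - closed_segment 0 (prim_point lattice ray) else {})"
  proof (cases "rational lattice ray")
    case True
    then obtain n where n: "0 < A n" "A n = B n" using rational_iff by blast
    let ?S = "U n + V n"
    have S: "?S \<in> right_line" unfolding right_line_eq using n by (intro UN_I[of n]) auto
    have Sw: "D ?S w = 0" using n D_V_w[of n] by (simp add: B_def)
    \<comment> \<open>The tie is unique, so the third piece of \<open>frontier_K\<close> starts from
      a single point.\<close>
    have "x \<in> right_line \<and> D x w = 0 \<longleftrightarrow> x = ?S" for x
      using S Sw right_line_on_ray[of x] tie_index_unique[OF n] by blast
    then have "{s *\<^sub>R x | s x. 1 < s \<and> x \<in> right_line \<and> D x w = 0} = {s *\<^sub>R ?S | s. 1 < s}" by auto
    also have "\<dots> = {s *\<^sub>R ?S | s. 0 \<le> s} - closed_segment 0 ?S"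
    proof -
      have D_S: "D (U n) ?S = 1" by simp
      have "s *\<^sub>R ?S \<in> closed_segment 0 ?S \<longleftrightarrow> 0 \<le> s \<and> s \<le> 1" for s
      proof
        assume "s *\<^sub>R ?S \<in> closed_segment 0 ?S"
        then obtain t where t: "0 \<le> t" "t \<le> 1" "s *\<^sub>R ?S = t *\<^sub>R ?S"
          by (auto simp: in_segment)
        then have "s * D (U n) ?S = t * D (U n) ?S" by (metis D_simps(4))
        then show "0 \<le> s \<and> s \<le> 1" using t D_S by simp
      qed (auto simp: in_segment)
      then show ?thesis by (auto simp: not_le)
    qed
    also have "{s *\<^sub>R ?S | s. 0 \<le> s} = ray"
    proof -
      have "s *\<^sub>R ?S = (s / A n) *\<^sub>R w" "s *\<^sub>R w = (s * A n) *\<^sub>R ?S" for s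
      proof -
        show "s *\<^sub>R w = (s * A n) *\<^sub>R ?S" using tie_w[OF n] by (metis scaleR_scaleR)
        have "(s / A n) *\<^sub>R w = (s / A n) *\<^sub>R (A n *\<^sub>R ?S)" using tie_w[OF n] by metis
        then show "s *\<^sub>R ?S = (s / A n) *\<^sub>R w" using n by simp
      qed
      moreover have "0 \<le> s / A n" "0 \<le> s * A n" if "0 \<le> s" for s using n that by auto
      ultimately show ?thesis unfolding ray_def by blast
    qed
    finally show ?thesis using True by (simp add: prim_point_eq[OF n])
  next
    case False
    then show ?thesis using rational_iff right_line_on_ray by (auto, metis)
  qed
  then show ?thesis
    unfolding Q_line_def P_line_eq convex_cone_hull_side K_def[symmetric] frontier_K by simp
qed

end

context ray_in_cone
begin

interpretation swap: ray_in_cone e2 e1 c2 c1 w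
  by (rule swapped)

lemma Q_line_left:
  "Q_line lattice e1 e2 ray e2 =
     frontier (convex hull {x \<in> lattice. x \<noteq> 0 \<and> x \<in> convex_cone hull (insert e2 ray)})"
proof -
  have "sheath e2 e1 ray = sheath e1 e2 ray"
    using sheath_eq swap.sheath_eq swap_sheath by simp
  then have "Q_line lattice e2 e1 ray e2 = Q_line lattice e1 e2 ray e2"
    unfolding Q_line_def P_line_def by (simp add: open_segment_commute)
  then show ?thesis using swap.Q_line_right by (simp only: swap_lattice)
qed

end


section \<open>Packets of symbols\<close>

text \<open>
  The packets are delimited by the indices \<open>start k\<close>: packet \<open>k\<close> is the longest run of the symbol
  \<open>packet_symbol k\<close> beginning at \<open>start k\<close>; only packet \<open>0\<close> can be empty.
\<close>

definition packet_symbol :: "nat \<Rightarrow> symbol" where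
  "packet_symbol k = (if even k then Sym_delta else Sym_gamma)"

lemma packet_symbol_Suc: "s \<noteq> packet_symbol k \<longleftrightarrow> s = packet_symbol (Suc k)"
  by (cases s) (auto simp: packet_symbol_def)

text \<open>In \<open>change\<close>, leaving \<open>idx\<close> counts as a change of symbol. So
  the assumption covers finite sheaths as well, and every \<open>LEAST\<close> in
  \<open>start\<close> is attained.\<close>

locale symbol_packets =
  fixes e1 e2 :: "'a::euclidean_space" and l :: "'a set" and idx :: "nat set" and sym :: "nat \<Rightarrow> symbol"
  defines "idx \<equiv> petal_indices e1 e2 l" and "sym \<equiv> petal_symbol e1 e2 l"
  assumes down: "j \<in> idx \<Longrightarrow> i \<le> j \<Longrightarrow> i \<in> idx"
    and zero: "0 \<in> idx"
    and change: "\<exists>j\<ge>i. j \<notin> idx \<or> sym j \<noteq> c"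
begin

primrec start :: "nat \<Rightarrow> nat" where
  "start 0 = 0"
| "start (Suc k) = (LEAST i. start k \<le> i \<and> (i \<notin> idx \<or> sym i \<noteq> packet_symbol k))"

declare start.simps(2) [simp del]

lemma start_Suc:
  "start k \<le> start (Suc k)" "start (Suc k) \<notin> idx \<or> sym (start (Suc k)) \<noteq> packet_symbol k"
  using LeastI_ex[OF change[of "start k" "packet_symbol k"]] by (simp_all add: start.simps(2))

lemma run:
  assumes "start k \<le> i" "i < start (Suc k)"
  shows "i \<in> idx" "sym i = packet_symbol k"
  using not_less_Least[OF assms(2)[unfolded start.simps(2)]] assms(1) by auto

lemma start_mono: "i \<le> j \<Longrightarrow> start i \<le> start j"
  by (rule lift_Suc_mono_le[of start]) (use start_Suc in auto)

lemma sym_start: "start (Suc k) \<in> idx \<Longrightarrow> sym (start (Suc k)) = packet_symbol (Suc k)"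
  using start_Suc(2)[of k] packet_symbol_Suc by blast

lemma start_strict:
  assumes "start (Suc k) \<in> idx"
  shows "start (Suc k) < start (Suc (Suc k))"
proof -
  have "start (Suc k) \<noteq> start (Suc (Suc k))"
    using start_Suc(2)[of "Suc k"] sym_start[OF assms] assms by auto
  then show ?thesis using start_Suc(1)[of "Suc k"] by simp
qed

text \<open>The numbers of the actual packets: beyond the last petal \<open>start\<close> becomes
  constant, outside \<open>idx\<close>. The number 0 belongs to \<open>J\<close> even if packet 0 is
  empty.\<close>

definition J :: "nat set" where "J = {k. start k \<in> idx}"

lemma J_down: "j \<in> J \<Longrightarrow> i \<le> j \<Longrightarrow> i \<in> J"
  using start_mono down by (auto simp: J_def)

lemma J_0: "0 \<in> J"
  by (simp add: J_def zero)

definition P :: "nat \<Rightarrow> nat set" where "P k = {start k..<start (Suc k)}"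

lemma P_Suc_nonempty: "Suc k \<in> J \<Longrightarrow> P (Suc k) \<noteq> {}"
  using start_strict by (auto simp: J_def P_def)

lemma P_0_nonempty: "P 0 \<noteq> {} \<longleftrightarrow> sym 0 = Sym_delta"
proof -
  have "0 < start (Suc 0)" if "sym 0 = Sym_delta"
    using start_Suc(2)[of 0] zero that by (cases "start (Suc 0)") (auto simp: packet_symbol_def)
  moreover have "sym 0 = Sym_delta" if "0 < start (Suc 0)"
    using run(2)[of 0 0] that by (simp add: packet_symbol_def)
  ultimately show ?thesis by (auto simp: P_def)
qed

lemma cover:
  assumes i: "i \<in> idx"
  obtains k where "k \<in> J" "i \<in> P k"
proof -
  have "\<exists>k. i < start k"
  proof (rule ccontr)
    assume "\<nexists>k. i < start k"
    then have le: "start k \<le> i" for k by (simp add: not_less)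
    \<comment> \<open>All starts would lie in \<open>idx\<close> and so increase strictly from
      number 1 on; the shift by one allows for an empty packet 0.\<close>
    have "k \<le> start (Suc k)" for k
    proof (induction k)
      case (Suc k)
      then show ?case using start_strict[OF down[OF i le[of "Suc k"]]] by simp
    qed simp
    then show False using le[of "Suc (Suc i)"] by (metis Suc_n_not_le_n le_trans)
  qed
  then obtain k where k: "i < start k" "\<And>j. j < k \<Longrightarrow> \<not> i < start j"
    using exists_least_iff[of "\<lambda>k. i < start k"] by blast
  then obtain k' where k': "k = Suc k'" by (cases k) auto
  have "start k' \<le> i" using k(2)[of k'] k' by simp
  then show ?thesis using that[of k'] k(1) k' down[OF i] by (auto simp: J_def P_def)
qed

lemma uniform_packet_iff:
  "uniform_packet e1 e2 l I \<longleftrightarrow>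
     I \<noteq> {} \<and> I \<subseteq> idx \<and> (\<forall>i \<in> I. \<forall>j \<in> I. {i..j} \<subseteq> I) \<and> (\<forall>i \<in> I. \<forall>j \<in> I. sym i = sym j)"
  by (simp add: uniform_packet_def idx_def sym_def)

lemma uniform_P: "P k \<noteq> {} \<Longrightarrow> uniform_packet e1 e2 l (P k)"
  unfolding uniform_packet_iff using run[of k] by (auto simp: P_def)

text \<open>To leave \<open>P k\<close>, a uniform interval would have to contain
  \<open>start (Suc k)\<close>, where the symbol changes or the petals end, or
  \<open>start k - 1\<close>, which carries the symbol of packet \<open>k - 1\<close>.\<close>

lemma uniform_subset_P:
  assumes M: "uniform_packet e1 e2 l M" and i: "i \<in> M" "i \<in> P k" and k: "k \<in> J"
  shows "M \<subseteq> P k"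
proof
  fix j assume j: "j \<in> M"
  have sym_i: "sym i = packet_symbol k" using run i by (simp add: P_def)
  note u = M[unfolded uniform_packet_iff, THEN conjunct2]
  note sub = u[THEN conjunct1] and interval = u[THEN conjunct2, THEN conjunct1, rule_format]
    and const = u[THEN conjunct2, THEN conjunct2, rule_format]
  have same: "sym m = packet_symbol k \<and> m \<in> idx" if "m \<in> M" for m
    using const[OF that i(1)] sub that sym_i by auto
  have between: "m \<in> M" if "min i j \<le> m" "m \<le> max i j" for m
    using interval[OF i(1) j] interval[OF j i(1)] that by (cases "i \<le> j") (auto simp: min_def max_def)
  show "j \<in> P k"
  proof (rule ccontr)
    assume "j \<notin> P k"
    then consider "start (Suc k) \<le> j" | "j < start k" by (force simp: P_def)
    then show False
    proof cases
      case 1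
      then have "start (Suc k) \<in> M" using i by (intro between) (auto simp: P_def)
      then show False using same start_Suc(2)[of k] by blast
    next
      case 2
      then obtain k' where k': "k = Suc k'" by (cases k) auto
      have "start k' < start k"
      proof (cases k')
        case 0
        then show ?thesis using 2 by simp
      next
        case (Suc n)
        have "k' \<in> J" using J_down[OF k] k' by simp
        then show ?thesis using start_strict[of n] Suc k' by (simp add: J_def)
      qed
      then have "sym (start k - 1) = packet_symbol k'" using k' by (intro run(2)) auto
      moreover have "start k - 1 \<in> M" using 2 i by (intro between) (auto simp: P_def)
      ultimately show False using same packet_symbol_Suc[of "packet_symbol k'" k'] k' by metis
    qed
  qed
qed

lemma maximal_packets_eq: "maximal_packets e1 e2 l = P ` {k \<in> J. P k \<noteq> {}}"
proof
  show "maximal_packets e1 e2 l \<subseteq> P ` {k \<in> J. P k \<noteq> {}}"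
  proof
    fix M assume M: "M \<in> maximal_packets e1 e2 l"
    then have u: "uniform_packet e1 e2 l M" and max: "\<And>J. uniform_packet e1 e2 l J \<Longrightarrow> M \<subseteq> J \<Longrightarrow> J = M"
      by (auto simp: maximal_packets_def)
    obtain i where i: "i \<in> M" "i \<in> idx" using u unfolding uniform_packet_iff by blast
    obtain k where k: "k \<in> J" "i \<in> P k" using cover[OF i(2)] .
    have "P k = M" using max uniform_P uniform_subset_P[OF u i(1) k(2,1)] k(2) by blast
    then show "M \<in> P ` {k \<in> J. P k \<noteq> {}}" using k by blast
  qed
  show "P ` {k \<in> J. P k \<noteq> {}} \<subseteq> maximal_packets e1 e2 l"
    unfolding maximal_packets_def using uniform_P uniform_subset_P by blast
qed

lemma finite_maximal_packet: "I \<in> maximal_packets e1 e2 l \<Longrightarrow> finite I"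
  by (auto simp: maximal_packets_eq P_def)

lemma start_strict_J:
  assumes "i < j" "j \<in> J" "P i \<noteq> {}"
  shows "start i < start j"
proof -
  have "start i < start (Suc i)" using assms by (simp add: P_def)
  then show ?thesis using start_mono[of "Suc i" j] assms(1) by simp
qed

lemma Inf_P: "P k \<noteq> {} \<Longrightarrow> Inf (P k) = start k"
  by (rule cInf_eq_minimum) (auto simp: P_def)

text \<open>If the first symbol is \<open>Sym_gamma\<close>, then \<open>P 0\<close> is empty and
  not among the maximal packets; the inserted empty packet takes its place, and the others are
  shifted by one.\<close>

lemma packet_eq_and_num:
  "(\<forall>k\<in>J. packet e1 e2 l k = P k) \<and> num_packets e1 e2 l = (if finite J then enat (card J) else \<infinity>)"
proof (cases "sym 0 = Sym_delta")
  case True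
  have ne: "P k \<noteq> {}" if "k \<in> J" for k
    using that True P_0_nonempty P_Suc_nonempty by (cases k) auto
  have mp: "maximal_packets e1 e2 l = P ` J" using ne by (auto simp: maximal_packets_eq)
  have mono: "Inf (P i) < Inf (P j)" if "i \<in> J" "j \<in> J" "i < j" for i j
    using start_strict_J[OF that(3,2)] ne that by (simp add: Inf_P)
  have "inj_on P J"
    by (rule linorder_inj_onI) (use mono in fastforce)+
  then have "finite (P ` J) \<longleftrightarrow> finite J" "card (P ` J) = card J"
    by (auto simp: finite_image_iff card_image)
  then have "num_packets e1 e2 l = (if finite J then enat (card J) else \<infinity>)"
    using True by (simp add: num_packets_def mp sym_def)
  moreover have "packet e1 e2 l k = P k" if "k \<in> J" for k
    using enum_by_image[of J Inf P k] mono J_down that True by (simp add: packet_def mp sym_def)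
  ultimately show ?thesis by blast
next
  case False
  have P0: "P 0 = {}" using False P_0_nonempty by blast
  define J' where "J' = {j. Suc j \<in> J}"
  have J: "J = insert 0 (Suc ` J')"
  proof (rule set_eqI)
    fix k show "k \<in> J \<longleftrightarrow> k \<in> insert 0 (Suc ` J')"
      by (cases k) (auto simp: J'_def J_0)
  qed
  have ne: "P (Suc k) \<noteq> {}" if "k \<in> J'" for k
    using that P_Suc_nonempty by (simp add: J'_def)
  have "{k \<in> J. P k \<noteq> {}} = Suc ` J'" using ne P0 by (auto simp: J)
  then have mp: "maximal_packets e1 e2 l = (\<lambda>j. P (Suc j)) ` J'" by (simp add: maximal_packets_eq image_image)
  have mono: "Inf (P (Suc i)) < Inf (P (Suc j))" if "i \<in> J'" "j \<in> J'" "i < j" for i j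
    using start_strict_J[of "Suc i" "Suc j"] ne that by (simp add: Inf_P J'_def)
  have "inj_on (\<lambda>j. P (Suc j)) J'"
    by (rule linorder_inj_onI) (use mono in fastforce)+
  then have fin: "finite ((\<lambda>j. P (Suc j)) ` J') \<longleftrightarrow> finite J'" and card: "card ((\<lambda>j. P (Suc j)) ` J') = card J'"
    by (auto simp: finite_image_iff card_image)
  have finJ: "finite J \<longleftrightarrow> finite J'" by (simp add: J finite_image_iff)
  have cardJ: "card J = Suc (card J')" if "finite J'" using that by (simp add: J card_image)
  have "num_packets e1 e2 l = (if finite J then enat (card J) else \<infinity>)"
    using False unfolding num_packets_def mp fin card finJ
    by (cases "finite J'") (simp_all add: sym_def cardJ one_enat_def)
  moreover have "packet e1 e2 l k = P k" if "k \<in> J" for k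
  proof (cases k)
    case 0
    then show ?thesis using False P0 by (simp add: packet_def sym_def)
  next
    case (Suc j)
    then have j: "j \<in> J'" using that by (simp add: J'_def)
    have "enum_by Inf ((\<lambda>j. P (Suc j)) ` J') j = P (Suc j)"
      by (rule enum_by_image[of J' Inf "\<lambda>j. P (Suc j)" j]) (use mono J_down j in \<open>auto simp: J'_def\<close>)
    then show ?thesis using False Suc by (simp add: packet_def mp sym_def)
  qed
  ultimately show ?thesis by blast
qed

lemmas packet_eq = packet_eq_and_num[THEN conjunct1, rule_format]
lemmas num_packets_eq = packet_eq_and_num[THEN conjunct2]

lemma J_finite_eq: "finite J \<Longrightarrow> J = {..<card J}"
proof -
  assume fin: "finite J"
  define m where "m = Max J"
  have "m \<in> J" using Max_in[OF fin] J_0 by (auto simp: m_def)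
  then have "J = {..m}" using Max_ge[OF fin] J_down by (auto simp: m_def)
  then show ?thesis by (simp add: lessThan_Suc_atMost)
qed

lemma J_infinite_eq: "infinite J \<Longrightarrow> J = UNIV"
  using J_down infinite_nat_iff_unbounded_le[of J] by (metis UNIV_eq_I)

end

section \<open>Symbols of the sheath and complete quotients of the inclination\<close>

context ray_in_cone
begin

text \<open>Each step subtracts a positive number from \<open>A + B\<close>, the denominator of the
  entry distance; so the order of entry is that of the algorithm.\<close>

lemma sum_strict:
  assumes "i < j" "0 < A j"
  shows "A j + B j < A i + B i"
  using assms
proof (induction i j rule: less_Suc_induct)
  case (1 i)
  have "0 < A i" using live_down[OF 1] by simp
  then show ?case using B_pos[of i] by (cases "B i \<le> A i") (auto simp: step_right step_left not_le)
next
  case (2 i j k)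
  then show ?case using live_down[of k j] by fastforce
qed

lemma entry_strict:
  assumes "i < j" "0 < A j"
  shows "infdist 0 (ray \<inter> triangle (chain i)) < infdist 0 (ray \<inter> triangle (chain j))"
proof -
  have live: "0 < A i" using live_down assms by (meson less_imp_le)
  have "infdist 0 (ray \<inter> triangle (chain k)) = norm w / (A k + B k)" if "0 < A k" for k
    using entry_distance[of "U k" "V k"] that by (auto simp: chain_UV petals_eq A_def B_def)
  moreover have "norm w / (A i + B i) < norm w / (A j + B j)"
    using sum_strict[OF assms] B_pos[of j] assms(2) w_neq_0 live B_pos[of i]
    by (intro divide_strict_left_mono) auto
  ultimately show ?thesis using assms live by simp
qed

lemma petal_eq: "0 < A i \<Longrightarrow> petal e1 e2 ray i = chain i"
  unfolding petal_def sheath_petals_eq petals_eq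
  by (rule enum_by_image) (use entry_strict live_down in auto)

lemma inj_on_chain: "inj_on chain {i. 0 < A i}"
  by (rule linorder_inj_onI) (use entry_strict in fastforce)+

lemma petal_indices_eq: "petal_indices e1 e2 ray = {i. 0 < A i}"
proof -
  have fin: "finite petals \<longleftrightarrow> finite {i. 0 < A i}" "card petals = card {i. 0 < A i}"
    unfolding petals_eq using inj_on_chain by (auto simp: finite_image_iff card_image)
  show ?thesis
    using tie_or_live
  proof
    assume "\<forall>i. 0 < A i"
    then show ?thesis by (simp add: petal_indices_def sheath_petals_eq fin)
  next
    assume "\<exists>n. 0 < A n \<and> A n = B n"
    then obtain n where n: "0 < A n" "A n = B n" by blast
    have live: "{i. 0 < A i} = {..n}" using tie_unique[OF n] by auto
    show ?thesis unfolding petal_indices_def sheath_petals_eq fin live by (auto simp: less_Suc_eq_le)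
  qed
qed

text \<open>Guarantees that the description in \<open>turn\<close> has at most one solution.\<close>

lemma sides_distinct: "closed_segment (U i) (U i + V i) \<noteq> closed_segment (V i) (U i + V i)"
proof
  assume "closed_segment (U i) (U i + V i) = closed_segment (V i) (U i + V i)"
  then have "{U i, U i + V i} = {V i, U i + V i}" by (simp add: closed_segment_eq)
  then have "U i = V i \<or> U i + V i = V i" by (auto simp: doubleton_eq_iff)
  then have "c1 (U i) = 0 \<or> D (U i) (V i) = 0" by (metis D_simps(5) add_cancel_right_left coords_simps(5))
  then show False using UV_coords[of i] by auto
qed

lemma turn_eq:
  assumes live: "0 < A (Suc i)"
  shows "turn e1 e2 ray i = (if B i < A i then Sym_delta else Sym_gamma)"
proof -
  have live': "0 < A i" using live_down[OF live] by simp
  have "A i \<noteq> B i" using live step_right(3)[of i] by auto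
  show ?thesis
    unfolding turn_def petal_eq[OF live] petal_eq[OF live'] chain_UV
  proof (rule the_equality)
    show "base (U (Suc i), V (Suc i)) = side (if B i < A i then Sym_delta else Sym_gamma) (U i, V i)"
      using \<open>A i \<noteq> B i\<close> by (auto simp: step_right step_left not_less closed_segment_commute)
    fix s assume s: "base (U (Suc i), V (Suc i)) = side s (U i, V i)"
    show "s = (if B i < A i then Sym_delta else Sym_gamma)"
    proof (cases "B i < A i")
      case True
      then have "side s (U i, V i) = closed_segment (U i) (U i + V i)"
        using s by (simp add: step_right)
      then show ?thesis using True sides_distinct[of i] by (cases s) simp_all
    next
      case False
      then have "A i < B i" using \<open>A i \<noteq> B i\<close> by simp
      then have "side s (U i, V i) = closed_segment (V i) (U i + V i)"
        using s closed_segment_commute[of "U i + V i" "V i"] by (simp add: step_left)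
      then show ?thesis using False sides_distinct[of i] by (cases s) simp_all
    qed
  qed
qed

lemma symbol_not_tie:
  assumes "0 < A i" "A i \<noteq> B i"
  shows "petal_symbol e1 e2 ray i = (if B i < A i then Sym_delta else Sym_gamma)"
proof -
  have "0 < A (Suc i)" using assms by (cases "B i \<le> A i") (auto simp: step_right step_left not_le)
  then show ?thesis by (simp add: petal_symbol_def petal_indices_eq turn_eq)
qed

lemma symbol_tie:
  assumes n: "0 < A n" "A n = B n"
  shows "petal_symbol e1 e2 ray n = (if n = 0 then Sym_delta else petal_symbol e1 e2 ray (n - 1))"
proof -
  have "A (Suc n) = 0" using n by (simp add: step_right)
  then show ?thesis
    using n by (cases n) (simp_all add: petal_symbol_def petal_indices_eq)
qed

lemma symbol_packets: "symbol_packets e1 e2 ray"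
proof
  fix i c
  show "\<exists>j\<ge>i. j \<notin> petal_indices e1 e2 ray \<or> petal_symbol e1 e2 ray j \<noteq> c"
    using tie_or_live
  proof
    assume live: "\<forall>i. 0 < A i"
    have no_tie: "A j \<noteq> B j" for j using live step_right(3)[of j] by (metis diff_self less_irrefl order_refl)
    obtain j where j: "i \<le> j" "A j \<le> B j" using ex_left_turn live by blast
    obtain k where k: "i \<le> k" "B k \<le> A k" using ex_right_turn live by blast
    have "A j < B j" "B k < A k" using j k no_tie by (metis le_less)+
    then have "petal_symbol e1 e2 ray j = Sym_gamma" "petal_symbol e1 e2 ray k = Sym_delta"
      using live by (simp_all add: symbol_not_tie)
    then show ?thesis using j k by (metis symbol.distinct(1))
  next
    assume "\<exists>n. 0 < A n \<and> A n = B n"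
    then obtain n where n: "0 < A n" "A n = B n" by blast
    have "max i (Suc n) \<notin> petal_indices e1 e2 ray" using tie_unique[OF n] by (auto simp: petal_indices_eq)
    then show ?thesis by (metis max.cobounded1)
  qed
qed (use live_down w_pos in \<open>auto simp: petal_indices_eq\<close>)

interpretation pk: symbol_packets e1 e2 ray "petal_indices e1 e2 ray" "petal_symbol e1 e2 ray"
  by (rule symbol_packets) simp_all

text \<open>The complete quotients of the continued fraction of \<open>A 0 / B 0\<close>; the parity
  tells which coordinate is being divided by the other.\<close>

definition complete_quotient :: "nat \<Rightarrow> real" where
  "complete_quotient k = (if even k then A (pk.start k) / B (pk.start k) else B (pk.start k) / A (pk.start k))"

lemma run_right:
  assumes "\<And>i. m \<le> i \<Longrightarrow> i < m + d \<Longrightarrow> B i < A i"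
  shows "A (m + d) = A m - real d * B m \<and> B (m + d) = B m"
  using assms
proof (induction d)
  case (Suc d)
  then have "A (m + d) = A m - real d * B m \<and> B (m + d) = B m" by simp
  moreover have "B (m + d) < A (m + d)" using Suc.prems by simp
  ultimately show ?case by (simp add: step_right algebra_simps)
qed simp

lemma run_left:
  assumes "\<And>i. m \<le> i \<Longrightarrow> i < m + d \<Longrightarrow> A i < B i"
  shows "B (m + d) = B m - real d * A m \<and> A (m + d) = A m"
  using assms
proof (induction d)
  case (Suc d)
  then have "B (m + d) = B m - real d * A m \<and> A (m + d) = A m" by simp
  moreover have "A (m + d) < B (m + d)" using Suc.prems by simp
  ultimately show ?case by (simp add: step_left algebra_simps)
qed simp

text \<open>The symbol of a tie petal is a convention and tells nothing about \<open>A\<close> and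
  \<open>B\<close>; that the next petal exists excludes this case.\<close>

lemma packet_direction:
  assumes "pk.start k \<le> i" "i < pk.start (Suc k)" "0 < A (Suc i)"
  shows "if even k then B i < A i else A i < B i"
proof -
  have "A i \<noteq> B i" using assms(3) step_right(3)[of i] by auto
  moreover have "0 < A i" using live_down[OF assms(3)] by simp
  ultimately show ?thesis
    using pk.run(2)[OF assms(1,2)] by (auto simp: symbol_not_tie packet_symbol_def split: if_splits)
qed

text \<open>Division by repeated subtraction, stopped at any \<open>m\<close> of the run: the last
  packet has to be evaluated at its tie, not at its end.\<close>

lemma complete_quotient_run:
  assumes m: "pk.start k \<le> m" "m \<le> pk.start (Suc k)" "0 < A m" and k: "0 < A (pk.start k)"
  shows "complete_quotient k = real (m - pk.start k) + (if even k then A m / B m else B m / A m)"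
proof -
  let ?s = "pk.start k" and ?d = "m - pk.start k"
  have md: "m = ?s + ?d" using m by simp
  have dir: "if even k then B i < A i else A i < B i" if "?s \<le> i" "i < ?s + ?d" for i
    using that m by (intro packet_direction) (auto intro: live_down[OF m(3)])
  show ?thesis
  proof (cases "even k")
    case True
    then have "A m = A ?s - real ?d * B ?s \<and> B m = B ?s" using run_right[of ?s ?d] dir md by auto
    then show ?thesis using True B_pos[of ?s] by (simp add: complete_quotient_def field_simps)
  next
    case False
    then have "B m = B ?s - real ?d * A ?s \<and> A m = A ?s" using run_left[of ?s ?d] dir md by auto
    then show ?thesis using False k by (simp add: complete_quotient_def field_simps)
  qed
qed

lemma complete_quotient_step:
  assumes "Suc k \<in> pk.J"
  shows "complete_quotient k = real (card (pk.P k)) + 1 / complete_quotient (Suc k)"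
proof -
  have live: "0 < A (pk.start (Suc k))" using assms by (simp add: pk.J_def petal_indices_eq)
  have "0 < A (pk.start k)" using live_down[OF live pk.start_Suc(1)] .
  then show ?thesis
    using complete_quotient_run[of k "pk.start (Suc k)"] live pk.start_Suc(1)[of k] by (auto simp: pk.P_def complete_quotient_def)
qed

text \<open>A tie petal repeats the symbol of its predecessor, or has \<open>Sym_delta\<close> if it
  is alone, so it cannot open a packet after packet 0.\<close>

lemma start_Suc_not_tie:
  assumes k: "Suc k \<in> pk.J"
  shows "A (pk.start (Suc k)) \<noteq> B (pk.start (Suc k))"
proof
  let ?m = "pk.start (Suc k)"
  assume tie: "A ?m = B ?m"
  have idx: "?m \<in> petal_indices e1 e2 ray" using k by (simp add: pk.J_def)
  have live: "0 < A ?m" using idx by (simp add: petal_indices_eq)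
  have sym: "petal_symbol e1 e2 ray ?m = packet_symbol (Suc k)" using pk.sym_start[OF idx] .
  have less: "pk.start k < ?m" if "k \<noteq> 0 \<or> ?m \<noteq> 0"
  proof (cases k)
    case 0
    then show ?thesis using that by simp
  next
    case (Suc j)
    then show ?thesis using pk.start_strict[of j] pk.J_down[OF k, of k] by (simp add: pk.J_def)
  qed
  show False
  proof (cases "?m = 0")
    case True
    then have "k = 0" using less by auto
    then show False using sym symbol_tie[OF live tie] True by (simp add: packet_symbol_def)
  next
    case False
    then have "petal_symbol e1 e2 ray (?m - 1) = packet_symbol k"
      using less by (intro pk.run(2)) auto
    then show False
      using sym symbol_tie[OF live tie] False packet_symbol_Suc[of "packet_symbol k" k] by simp
  qed
qed

lemma complete_quotient_Suc_ge_1: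
  assumes k: "Suc k \<in> pk.J"
  shows "1 \<le> complete_quotient (Suc k)"
proof -
  let ?m = "pk.start (Suc k)"
  have idx: "?m \<in> petal_indices e1 e2 ray" using k by (simp add: pk.J_def)
  then have live: "0 < A ?m" by (simp add: petal_indices_eq)
  have "petal_symbol e1 e2 ray ?m = packet_symbol (Suc k)" using pk.sym_start[OF idx] .
  then show ?thesis
    using symbol_not_tie[OF live start_Suc_not_tie[OF k]] live B_pos[of ?m]
    by (auto simp: complete_quotient_def packet_symbol_def split: if_splits)
qed

lemma card_P_Suc_ge_1: "Suc k \<in> pk.J \<Longrightarrow> 1 \<le> card (pk.P (Suc k))"
  using pk.P_Suc_nonempty[of k] by (simp add: pk.P_def)

text \<open>The packet ends with the tie petal \<open>n\<close>. The \<open>n - start k\<close>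
  petals before it are genuine subtractions, and the ratio 1 at the tie counts petal
  \<open>n\<close> itself.\<close>

lemma complete_quotient_last:
  assumes k: "k \<in> pk.J" "Suc k \<notin> pk.J"
  shows "complete_quotient k = real (card (pk.P k))"
proof -
  have live: "0 < A (pk.start k)" and dead: "\<not> 0 < A (pk.start (Suc k))"
    using k by (auto simp: pk.J_def petal_indices_eq)
  then obtain n where n: "0 < A n" "A n = B n" using tie_or_live by blast
  have le: "pk.start k \<le> n" "n < pk.start (Suc k)"
    using tie_unique[OF n] live dead by (auto simp: not_le[symmetric])
  have "pk.start (Suc k) - 1 \<in> petal_indices e1 e2 ray" using le by (intro pk.run(1)[of k]) auto
  then have "pk.start (Suc k) = Suc n" using tie_unique[OF n] le by (auto simp: petal_indices_eq)
  then show ?thesis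
    using complete_quotient_run[OF le(1) _ n(1) live] n le by (simp add: pk.P_def)
qed

lemma cfrac_complete_quotient:
  assumes fin: "finite pk.J" and k: "k < card pk.J"
  shows "cfrac (map (\<lambda>k. real (card (pk.P k))) [k..<card pk.J]) = complete_quotient k"
proof -
  define a where "a = (\<lambda>k. real (card (pk.P k)))"
  have J: "j \<in> pk.J \<longleftrightarrow> j < card pk.J" for j using pk.J_finite_eq[OF fin] by blast
  have "cfrac (map a [k..<Suc (k + n)]) = complete_quotient k" if "Suc (k + n) = card pk.J" for k n
    using that
  proof (induction n arbitrary: k)
    case 0
    then have "complete_quotient k = a k" unfolding a_def using J[of k] J[of "Suc k"] by (intro complete_quotient_last) simp_all
    then show ?case by simp
  next
    case (Suc n)
    have "cfrac (map a [Suc k..<Suc (Suc k + n)]) = complete_quotient (Suc k)" using Suc by simp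
    moreover have "complete_quotient k = a k + 1 / complete_quotient (Suc k)"
      unfolding a_def by (rule complete_quotient_step) (use Suc.prems J in simp)
    ultimately show ?case by (simp only: add_Suc_right cfrac_upt_Suc)
  qed
  from this[of k "card pk.J - Suc k"] show ?thesis using k by (simp add: a_def)
qed

lemma inclination_eq: "inclination e1 e2 ray = c1 w / c2 w"
  unfolding inclination_def
proof (rule the_equality)
  have "w = c1 w *\<^sub>R e1 + c2 w *\<^sub>R e2" by (rule expand)
  moreover have "w \<in> ray - {0}" using w_neq_0 by (auto simp: ray_def intro!: exI[of _ 1])
  ultimately show "\<exists>x1 x2. x1 *\<^sub>R e1 + x2 *\<^sub>R e2 \<in> ray - {0} \<and> c1 w / c2 w = x1 / x2" by metis
  fix r assume "\<exists>x1 x2. x1 *\<^sub>R e1 + x2 *\<^sub>R e2 \<in> ray - {0} \<and> r = x1 / x2"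
  then obtain x1 x2 t where t: "x1 *\<^sub>R e1 + x2 *\<^sub>R e2 = t *\<^sub>R w" "x1 *\<^sub>R e1 + x2 *\<^sub>R e2 \<noteq> 0" "r = x1 / x2"
    by (auto simp: ray_def)
  have "x1 = t * c1 w" "x2 = t * c2 w"
    using arg_cong[OF t(1), of c1] arg_cong[OF t(1), of c2] by simp_all
  moreover have "t \<noteq> 0" using t by auto
  ultimately show "r = c1 w / c2 w" using t(3) by simp
qed

theorem has_cfrac_inclination:
  "has_cfrac (inclination e1 e2 ray) (\<lambda>k. real (card (packet e1 e2 ray k))) (num_packets e1 e2 ray)"
proof -
  let ?a = "\<lambda>k. real (card (pk.P k))" and ?b = "\<lambda>k. real (card (packet e1 e2 ray k))"
  have complete_quotient_0: "complete_quotient 0 = c1 w / c2 w" by (simp add: complete_quotient_def)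
  show ?thesis
  proof (cases "finite pk.J")
    case True
    have pos: "0 < card pk.J" using True pk.J_0 by (auto simp: card_gt_0_iff)
    have map_eq: "map ?b [0..<card pk.J] = map ?a [0..<card pk.J]"
    proof (rule map_cong[OF refl])
      fix k assume "k \<in> set [0..<card pk.J]"
      then have "k \<in> pk.J" using pk.J_finite_eq[OF True] by auto
      then show "?b k = ?a k" by (simp only: pk.packet_eq)
    qed
    then show ?thesis
      using pos cfrac_complete_quotient[OF True pos]
      by (simp only: has_cfrac_def pk.num_packets_eq True if_True enat.case map_eq inclination_eq complete_quotient_0)
  next
    case False
    have UNIV: "j \<in> pk.J" for j using pk.J_infinite_eq[OF False] by simp
    have "(\<lambda>n. cfrac (map ?a [0..<Suc n])) \<longlonglongrightarrow> complete_quotient 0"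
    proof (rule cfrac_tendsto)
      fix j
      show "1 \<le> ?a (Suc j)" using card_P_Suc_ge_1[OF UNIV, of j] by simp
      show "1 \<le> complete_quotient (Suc j)" by (rule complete_quotient_Suc_ge_1[OF UNIV])
      show "complete_quotient j = ?a j + 1 / complete_quotient (Suc j)" by (rule complete_quotient_step[OF UNIV])
    qed
    moreover have "?b = ?a" using pk.packet_eq[OF UNIV] by simp
    ultimately show ?thesis
      using False by (simp add: has_cfrac_def pk.num_packets_eq inclination_eq complete_quotient_0 del: upt_Suc)
  qed
qed

text \<open>Ensures that \<open>card\<close> gives true cardinalities, since it is 0 on infinite
  sets.\<close>

lemma finite_packets: "I \<in> maximal_packets e1 e2 ray \<Longrightarrow> finite I"
  by (rule pk.finite_maximal_packet)

end

theorem proposition8p7: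
  fixes N l :: "'a::euclidean_space set" and e1 e2 :: 'a
  assumes "DIM('a) = 2"
    and "lattice_basis N e1 e2"
    and "half_line_from_0 l"
    and "l - {0} \<subseteq> interior (convex_cone hull {e1, e2})"
  shows "(\<forall>e \<in> {e1, e2}.
            Q_line N e1 e2 l e =
            frontier (convex hull {x \<in> N. x \<noteq> 0 \<and> x \<in> convex_cone hull (insert e l)})) \<and>
         (\<forall>I \<in> maximal_packets e1 e2 l. finite I) \<and>
         has_cfrac (inclination e1 e2 l) (\<lambda>k. real (card (packet e1 e2 l k)))
           (num_packets e1 e2 l)"
proof -
  have span: "span {e1, e2} = UNIV" and ind: "independent {e1, e2}" and neq: "e1 \<noteq> e2"
  proof -
    show ind: "independent {e1, e2}" and neq: "e1 \<noteq> e2" using assms(2) by (auto simp: lattice_basis_def)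
    \<comment> \<open>The dimension is used here: two independent vectors span the plane.\<close>
    have "card {e1, e2} = DIM('a)" using neq assms(1) by simp
    then show "span {e1, e2} = UNIV"
      using card_ge_dim_independent[of "{e1, e2}" UNIV] ind by (auto simp: dim_UNIV)
  qed
  obtain c1 where c1: "linear c1" "c1 e1 = (1 :: real)" "c1 e2 = 0"
    using linear_independent_extend[OF ind, of "\<lambda>x. if x = e1 then 1 else 0"] neq by auto
  obtain c2 where c2: "linear c2" "c2 e1 = (0 :: real)" "c2 e2 = 1"
    using linear_independent_extend[OF ind, of "\<lambda>x. if x = e1 then 0 else 1"] neq by auto
  note basis = c1(2) c2(2) c1(3) c2(3)
  have expand: "x = c1 x *\<^sub>R e1 + c2 x *\<^sub>R e2" for x
  proof -
    have "x \<in> span {e1, e2}" using span by simp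
    then obtain p where "x - p *\<^sub>R e1 \<in> span {e2}" by (auto simp: span_breakdown_eq)
    then obtain q where "x - p *\<^sub>R e1 = q *\<^sub>R e2" by (auto simp: span_singleton)
    then have x: "x = p *\<^sub>R e1 + q *\<^sub>R e2" by (simp add: algebra_simps)
    then have "c1 x = p" "c2 x = q"
      using basis by (simp_all add: linear_add linear_cmul c1(1) c2(1))
    then show ?thesis using x by simp
  qed
  interpret plane_coords e1 e2 c1 c2
    by (intro plane_coords.intro c1(1) c2(1) basis expand)
  obtain w where w: "w \<noteq> 0" "l = {t *\<^sub>R w | t. 0 \<le> t}"
    using assms(3) by (auto simp: half_line_from_0_def)
  have "1 *\<^sub>R w \<in> l" unfolding w(2) by (intro CollectI exI[of _ 1]) simp
  then have int: "w \<in> interior (convex_cone hull {e1, e2})" using assms(4) w(1) by auto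
  have "convex_cone hull {e1, e2} \<subseteq> {x. 0 \<le> c1 x \<and> 0 \<le> c2 x}"
    by (rule hull_minimal) (auto simp: convex_cone_iff)
  then have "convex_cone hull {e1, e2} \<subseteq> {x. 0 \<le> c1 x}" "convex_cone hull {e1, e2} \<subseteq> {x. 0 \<le> c2 x}"
    by auto
  then have "0 < c1 w" "0 < c2 w"
    using interior_halfspace_strict[OF linear_c1 _ _ int, of 0 "- e1"]
      interior_halfspace_strict[OF linear_c2 _ _ int, of 0 "- e2"] by simp_all
  then interpret ray_in_cone e1 e2 c1 c2 w
    by unfold_locales
  have l: "l = ray" unfolding w(2) ray_def by simp
  have N: "N = lattice"
  proof
    show "N \<subseteq> lattice" using assms(2) by (auto simp: lattice_basis_def lattice_def)
    show "lattice \<subseteq> N"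
    proof
      fix x assume "x \<in> lattice"
      then obtain m n where "c1 x = of_int m" "c2 x = of_int n" by (auto simp: lattice_def elim!: Ints_cases)
      then have "x = of_int m *\<^sub>R e1 + of_int n *\<^sub>R e2" using expand[of x] by simp
      then show "x \<in> N" using assms(2) by (auto simp: lattice_basis_def)
    qed
  qed
  show ?thesis
    unfolding l N using Q_line_right Q_line_left finite_packets has_cfrac_inclination by blast
qed


end
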